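(* Let $q\in\mathbb{C}\setminus\{0\}$ be not a root of $1$. There exist no $U_q(\mathfrak{sl}_2)$-symmetries on $\operatorname{Pol}(\mathbb{D})_q$ with grading jump $\operatorname{GJ}<-1$.
   Context: The ground field is $\mathbb{C}$. The quantum disc $\operatorname{Pol}(\mathbb{D})_q$ is the unital $\mathbb{C}$-algebra generated by $z,z^*$ subject to the single relation $zz^*=q^2z^*z+1-q^2$; it is considered as an algebra without involution, so $z^*$ is just a symbol for a second generator. The algebra is graded, $\operatorname{Pol}(\mathbb{D})_q=\bigoplus_{k\in\mathbb{Z}}\mathcal{A}_k$, where $\mathcal{A}_k$ is the linear span of $\{z^i(z^* )^j : i-j=k\}$. $U_q(\mathfrak{sl}_2)$ is the unital associative algebra generated by $\mathsf{k},\mathsf{k}^{-1},\mathsf{e},\mathsf{f}$ subject to $\mathsf{k}^{-1}\mathsf{k}=\mathsf{k}\mathsf{k}^{-1}=\mathbf{1}$, $\mathsf{ke}=q^2\mathsf{ek}$, $\mathsf{kf}=q^{-2}\mathsf{fk}$, $\mathsf{ef}-\mathsf{fe}=\frac{\mathsf{k}-\mathsf{k}^{-1}}{q-q^{-1}}$, with Hopf algebra structure $\Delta(\mathsf{k})=\mathsf{k}\otimes\mathsf{k}$, $\Delta(\mathsf{e})=\mathbf{1}\otimes\mathsf{e}+\mathsf{e}\otimes\mathsf{k}$, $\Delta(\mathsf{f})=\mathsf{f}\otimes\mathbf{1}+\mathsf{k}^{-1}\otimes\mathsf{f}$, $\mathsf{S}(\mathsf{k})=\mathsf{k}^{-1}$,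 $\mathsf{S}(\mathsf{e})=-\mathsf{ek}^{-1}$, $\mathsf{S}(\mathsf{f})=-\mathsf{kf}$, $\varepsilon(\mathsf{k})=1$, $\varepsilon(\mathsf{e})=\varepsilon(\mathsf{f})=0$. For a Hopf algebra $H$ and a unital algebra $A$, an $H$-symmetry on $A$ is a homomorphism of algebras $\pi:H\to\operatorname{End}_{\mathbb{C}}A$ such that $\pi(h)(ab)=\sum_{(h)}\pi(h_{(1)})(a)\,\pi(h_{(2)})(b)$ and $\pi(h)(\mathbf{1})=\varepsilon(h)\mathbf{1}$ for all $h\in H$, $a,b\in A$. Grading jump: for every $U_q(\mathfrak{sl}_2)$-symmetry $\pi$ on $\operatorname{Pol}(\mathbb{D})_q$, if $\pi(\mathsf{e})$ and $\pi(\mathsf{f})$ are not both identically zero, then there is a unique non-zero integer $n$ such that $\pi(\mathsf{e})\mathcal{A}_k\subset\mathcal{A}_{k+n}$ and $\pi(\mathsf{f})\mathcal{A}_k\subset\mathcal{A}_{k-n}$ for all $k\in\mathbb{Z}$; this $n$ is called the grading jump $\operatorname{GJ}$ of $\pi$. If $\pi(\mathsf{e})=\pi(\mathsf{f})=0$, one sets $\operatorname{GJ}=0$. *)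

theory Defs
  imports
    Complex_Main
    "HOL-Library.Poly_Mapping"
    "HOL-Algebra.QuotRing"
    "HOL-Algebra.Module"
begin

section \<open>Algebras over the complex numbers\<close>

text \<open>
  A (unital, associative, not necessarily commutative) complex algebra is represented by a
  \<^typ>\<open>(complex, 'a) module\<close> record, whose ring fields carry the multiplication.  The locale
  \<^locale>\<open>algebra\<close> of the library is not used, since it is restricted to commutative algebras.
\<close>

definition complex_alg :: "(complex, complex) module" where
  "complex_alg = \<lparr>carrier = UNIV, mult = (*), one = 1, zero = 0, add = (+), smult = (*)\<rparr>"

definition alg_hom ::
  "(complex, 'a, 'm) module_scheme \<Rightarrow> (complex, 'b, 'n) module_scheme \<Rightarrow> ('a \<Rightarrow> 'b) set" where
  "alg_hom A B = {h \<in> ring_hom A B.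
     \<forall>c. \<forall>x\<in>carrier A. h (c \<odot>\<^bsub>A\<^esub> x) = c \<odot>\<^bsub>B\<^esub> h x}"

definition opposite_alg :: "(complex, 'a) module \<Rightarrow> (complex, 'a) module" where
  "opposite_alg A = A\<lparr>mult := \<lambda>x y. y \<otimes>\<^bsub>A\<^esub> x\<rparr>"

definition lin_span :: "(complex, 'a, 'm) module_scheme \<Rightarrow> 'a set \<Rightarrow> 'a set" where
  "lin_span A S = \<Inter>{N. submodule N complex_alg A \<and> S \<subseteq> N}"

text \<open>
  Linear maps are made extensional, so that equality in the endomorphism algebra is equality of
  the maps on the carrier.
\<close>

definition End_alg :: "(complex, 'a, 'm) module_scheme \<Rightarrow> (complex, 'a \<Rightarrow> 'a) module" where
  "End_alg A =
    \<lparr>carrier = {T \<in> carrier A \<rightarrow>\<^sub>E carrier A.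
       (\<forall>x\<in>carrier A. \<forall>y\<in>carrier A. T (x \<oplus>\<^bsub>A\<^esub> y) = T x \<oplus>\<^bsub>A\<^esub> T y) \<and>
       (\<forall>c. \<forall>x\<in>carrier A. T (c \<odot>\<^bsub>A\<^esub> x) = c \<odot>\<^bsub>A\<^esub> T x)},
     mult = compose (carrier A),
     one = (\<lambda>x\<in>carrier A. x),
     zero = (\<lambda>x\<in>carrier A. \<zero>\<^bsub>A\<^esub>),
     add = (\<lambda>S T. \<lambda>x\<in>carrier A. S x \<oplus>\<^bsub>A\<^esub> T x),
     smult = (\<lambda>c T. \<lambda>x\<in>carrier A. c \<odot>\<^bsub>A\<^esub> T x)\<rparr>"

definition quotient_alg ::
  "(complex, 'a, 'm) module_scheme \<Rightarrow> 'a set \<Rightarrow> (complex, 'a set) module" where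
  "quotient_alg A I = ring.extend (A Quot I)
     (module.fields (\<lambda>c X. \<Union>x\<in>X. I +>\<^bsub>A\<^esub> (c \<odot>\<^bsub>A\<^esub> x)))"


section \<open>Monoid algebras\<close>

definition monoid_alg :: "('m, 'k) monoid_scheme \<Rightarrow> (complex, 'm \<Rightarrow>\<^sub>0 complex) module" where
  "monoid_alg M =
    \<lparr>carrier = {s. Poly_Mapping.keys s \<subseteq> carrier M},
     mult = (\<lambda>s t. \<Sum>x\<in>Poly_Mapping.keys s. \<Sum>y\<in>Poly_Mapping.keys t.
        Poly_Mapping.single (x \<otimes>\<^bsub>M\<^esub> y) (Poly_Mapping.lookup s x * Poly_Mapping.lookup t y)),
     one = Poly_Mapping.single \<one>\<^bsub>M\<^esub> 1,
     zero = 0,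
     add = (+),
     smult = (\<lambda>c. Poly_Mapping.map ((*) c))\<rparr>"

context
  fixes M :: "('m, 'k) monoid_scheme" (structure)
begin

private abbreviation mmult (infixl \<open>\<star>\<close> 70) where
  "s \<star> t \<equiv> mult (monoid_alg M) s t"

private lemma mmult_superset:
  assumes "finite S" "Poly_Mapping.keys s \<subseteq> S" "finite T" "Poly_Mapping.keys t \<subseteq> T"
  shows "s \<star> t = (\<Sum>x\<in>S. \<Sum>y\<in>T.
    Poly_Mapping.single (x \<otimes> y) (Poly_Mapping.lookup s x * Poly_Mapping.lookup t y))"
proof -
  have "s \<star> t = (\<Sum>x\<in>Poly_Mapping.keys s. \<Sum>y\<in>T.
    Poly_Mapping.single (x \<otimes> y) (Poly_Mapping.lookup s x * Poly_Mapping.lookup t y))"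
    unfolding monoid_alg_def
    using assms by (simp, intro sum.cong[OF refl] sum.mono_neutral_left) (auto simp: in_keys_iff)
  also have "\<dots> = (\<Sum>x\<in>S. \<Sum>y\<in>T.
    Poly_Mapping.single (x \<otimes> y) (Poly_Mapping.lookup s x * Poly_Mapping.lookup t y))"
    using assms by (intro sum.mono_neutral_left) (auto simp: in_keys_iff)
  finally show ?thesis .
qed

private lemma mmult_add_left: "(s + s') \<star> t = s \<star> t + s' \<star> t"
proof -
  let ?S = "Poly_Mapping.keys s \<union> Poly_Mapping.keys s'"
  have "Poly_Mapping.keys (s + s') \<subseteq> ?S" by (rule Poly_Mapping.keys_add)
  then show ?thesis
    by (subst (1 2 3) mmult_superset[of ?S _ "Poly_Mapping.keys t"])
      (auto simp: lookup_add distrib_right single_add sum.distrib)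
qed

private lemma mmult_add_right: "s \<star> (t + t') = s \<star> t + s \<star> t'"
proof -
  let ?T = "Poly_Mapping.keys t \<union> Poly_Mapping.keys t'"
  have "Poly_Mapping.keys (t + t') \<subseteq> ?T" by (rule Poly_Mapping.keys_add)
  then show ?thesis
    by (subst (1 2 3) mmult_superset[of "Poly_Mapping.keys s" _ ?T])
      (auto simp: lookup_add distrib_left single_add sum.distrib)
qed

private lemma mmult_zero: "0 \<star> t = 0" "s \<star> 0 = 0"
  by (simp_all add: monoid_alg_def)

private lemma mmult_single:
  "Poly_Mapping.single x a \<star> Poly_Mapping.single y b = Poly_Mapping.single (x \<otimes> y) (a * b)"
  by (subst mmult_superset[of "{x}" _ "{y}"]) auto

private lemma decompose: "s = (\<Sum>x\<in>Poly_Mapping.keys s. Poly_Mapping.single x (Poly_Mapping.lookup s x))"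
  by (rule poly_mapping_eqI)
    (auto simp: lookup_sum lookup_single when_def in_keys_iff sum.delta if_distrib cong: if_cong)

private lemma carrier_induct [consumes 1, case_names zero add]:
  assumes "s \<in> carrier (monoid_alg M)" "P 0"
    "\<And>x a s. x \<in> carrier M \<Longrightarrow> P s \<Longrightarrow> P (Poly_Mapping.single x a + s)"
  shows "P s"
proof -
  have "P (\<Sum>x\<in>A. Poly_Mapping.single x (f x))" if "finite A" "A \<subseteq> carrier M" for A f
    using that by (induction A) (auto intro: assms)
  from this[of "Poly_Mapping.keys s" "Poly_Mapping.lookup s"] assms(1) show ?thesis
    by (simp add: decompose[symmetric] monoid_alg_def)
qed

private lemma mmult_closed:
  assumes "monoid M" "s \<in> carrier (monoid_alg M)" "t \<in> carrier (monoid_alg M)"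
  shows "s \<star> t \<in> carrier (monoid_alg M)"
proof -
  interpret monoid M by fact
  have "x \<otimes> y \<in> carrier M" if "x \<in> Poly_Mapping.keys s" "y \<in> Poly_Mapping.keys t" for x y
    using that assms(2,3) by (auto simp: monoid_alg_def)
  then have "Poly_Mapping.keys (\<Sum>y\<in>Poly_Mapping.keys t. Poly_Mapping.single (x \<otimes> y)
      (Poly_Mapping.lookup s x * Poly_Mapping.lookup t y)) \<subseteq> carrier M"
    if "x \<in> Poly_Mapping.keys s" for x
    using that by (intro order.trans[OF Poly_Mapping.keys_sum]) (auto split: if_splits)
  then show ?thesis
    unfolding monoid_alg_def
    by (simp, intro order.trans[OF Poly_Mapping.keys_sum]) blast
qed

lemma ring_monoid_alg:
  assumes "monoid M"
  shows "ring (monoid_alg M)"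
proof -
  interpret monoid M by fact
  let ?A = "monoid_alg M"
  have assoc1: "(Poly_Mapping.single x a \<star> Poly_Mapping.single y b) \<star> u
      = Poly_Mapping.single x a \<star> (Poly_Mapping.single y b \<star> u)"
    if "u \<in> carrier ?A" "x \<in> carrier M" "y \<in> carrier M" for x y a b u
    using that by (induction rule: carrier_induct)
      (auto simp: mmult_zero mmult_add_right mmult_single m_assoc mult.assoc)
  have assoc2: "(Poly_Mapping.single x a \<star> t) \<star> u = Poly_Mapping.single x a \<star> (t \<star> u)"
    if "t \<in> carrier ?A" "u \<in> carrier ?A" "x \<in> carrier M" for x a t u
    using that by (induction rule: carrier_induct)
      (auto simp: mmult_zero mmult_add_left mmult_add_right assoc1)
  have assoc3: "(s \<star> t) \<star> u = s \<star> (t \<star> u)"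
    if "s \<in> carrier ?A" "t \<in> carrier ?A" "u \<in> carrier ?A" for s t u
    using that by (induction rule: carrier_induct)
      (auto simp: mmult_zero mmult_add_left assoc2)
  have one: "Poly_Mapping.single \<one> 1 \<star> s = s" "s \<star> Poly_Mapping.single \<one> 1 = s"
    if "s \<in> carrier ?A" for s
    using that by (induction rule: carrier_induct; simp add: mmult_zero mmult_add_left mmult_add_right mmult_single)+
  have sel: "one ?A = Poly_Mapping.single \<one> 1" "zero ?A = 0" "add ?A = (+)"
    "carrier ?A = {s. Poly_Mapping.keys s \<subseteq> carrier M}"
    by (simp_all add: monoid_alg_def)
  show ?thesis
  proof (rule ringI)
    show "abelian_group ?A"
    proof (rule abelian_groupI)
      fix s assume "s \<in> carrier ?A"
      then show "\<exists>t\<in>carrier ?A. t \<oplus>\<^bsub>?A\<^esub> s = \<zero>\<^bsub>?A\<^esub>"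
        by (intro bexI[of _ "- s"]) (auto simp: sel)
    next
      fix s t assume "s \<in> carrier ?A" "t \<in> carrier ?A"
      then show "s \<oplus>\<^bsub>?A\<^esub> t \<in> carrier ?A"
        using Poly_Mapping.keys_add[of s t] by (auto simp: sel)
    qed (auto simp: sel add.assoc add.commute)
    show "Group.monoid ?A"
      by (rule monoidI) (auto simp: sel(1) one assoc3 intro: mmult_closed[OF assms], auto simp: sel)
  qed (auto simp: sel(3) mmult_add_left mmult_add_right)
qed

end


section \<open>Algebras given by generators and relations\<close>

definition word_monoid :: "'g list monoid" where
  "word_monoid = \<lparr>carrier = UNIV, mult = (@), one = []\<rparr>"

abbreviation free_alg :: "(complex, 'g list \<Rightarrow>\<^sub>0 complex) module" where
  "free_alg \<equiv> monoid_alg word_monoid"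

definition presented_alg ::
  "('g list \<Rightarrow>\<^sub>0 complex) set \<Rightarrow> (complex, ('g list \<Rightarrow>\<^sub>0 complex) set) module" where
  "presented_alg R = quotient_alg free_alg (Idl\<^bsub>free_alg\<^esub> R)"

definition gen :: "('g list \<Rightarrow>\<^sub>0 complex) set \<Rightarrow> 'g \<Rightarrow> ('g list \<Rightarrow>\<^sub>0 complex) set" where
  "gen R g = Idl\<^bsub>free_alg\<^esub> R +>\<^bsub>free_alg\<^esub> Poly_Mapping.single [g] 1"

text \<open>
  The algebra homomorphism with prescribed values on the generators.  It is unique, and it exists
  whenever the prescribed values satisfy the relations, as they do in all uses below.
\<close>

definition hom_on_gens ::
  "('g list \<Rightarrow>\<^sub>0 complex) set \<Rightarrow> (complex, 'b) module \<Rightarrow> ('g \<Rightarrow> 'b)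
     \<Rightarrow> (('g list \<Rightarrow>\<^sub>0 complex) set \<Rightarrow> 'b)" where
  "hom_on_gens R B \<phi> = (THE h. h \<in> alg_hom (presented_alg R) B \<and>
     h \<in> extensional (carrier (presented_alg R)) \<and> (\<forall>g. h (gen R g) = \<phi> g))"


section \<open>Tensor products\<close>

text \<open>
  The algebra \<open>A \<otimes> B\<close> is the free vector space on the pairs \<open>(x, y)\<close>, with the product
  \<open>(x, y) (x', y') = (x x', y y')\<close>, modulo bilinearity.  Multiplying one of the relators below
  by a pair gives a relator again, so the ideal they generate is just their linear span.
\<close>

definition bilinear_relators ::
  "(complex, 'a) module \<Rightarrow> (complex, 'b) module \<Rightarrow> ('a \<times> 'b \<Rightarrow>\<^sub>0 complex) set" where
  "bilinear_relators A B =
     {Poly_Mapping.single (x \<oplus>\<^bsub>A\<^esub> x', y) 1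
        - Poly_Mapping.single (x, y) 1 - Poly_Mapping.single (x', y) 1 |
        x x' y. x \<in> carrier A \<and> x' \<in> carrier A \<and> y \<in> carrier B}
   \<union> {Poly_Mapping.single (x, y \<oplus>\<^bsub>B\<^esub> y') 1
        - Poly_Mapping.single (x, y) 1 - Poly_Mapping.single (x, y') 1 |
        x y y'. x \<in> carrier A \<and> y \<in> carrier B \<and> y' \<in> carrier B}
   \<union> {Poly_Mapping.single (c \<odot>\<^bsub>A\<^esub> x, y) 1 - Poly_Mapping.single (x, y) c |
        c x y. x \<in> carrier A \<and> y \<in> carrier B}
   \<union> {Poly_Mapping.single (x, c \<odot>\<^bsub>B\<^esub> y) 1 - Poly_Mapping.single (x, y) c |
        c x y. x \<in> carrier A \<and> y \<in> carrier B}"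

definition tensor_alg ::
  "(complex, 'a) module \<Rightarrow> (complex, 'b) module \<Rightarrow> (complex, ('a \<times> 'b \<Rightarrow>\<^sub>0 complex) set) module"
  where
  "tensor_alg A B = quotient_alg (monoid_alg (A \<times>\<times> B))
     (Idl\<^bsub>monoid_alg (A \<times>\<times> B)\<^esub> (bilinear_relators A B))"

definition tensor_elt ::
  "(complex, 'a) module \<Rightarrow> (complex, 'b) module \<Rightarrow> 'a \<Rightarrow> 'b \<Rightarrow> ('a \<times> 'b \<Rightarrow>\<^sub>0 complex) set" where
  "tensor_elt A B x y = Idl\<^bsub>monoid_alg (A \<times>\<times> B)\<^esub> (bilinear_relators A B)
     +>\<^bsub>monoid_alg (A \<times>\<times> B)\<^esub> Poly_Mapping.single (x, y) 1"


section \<open>Hopf algebra symmetries\<close>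

record 'a hopf_algebra = "(complex, 'a) module" +
  comult :: "'a \<Rightarrow> ('a \<times> 'a \<Rightarrow>\<^sub>0 complex) set"
  counit :: "'a \<Rightarrow> complex"
  antipode :: "'a \<Rightarrow> 'a"

text \<open>
  A coset \<open>comult H h\<close> consists of the formal sums \<open>s\<close> of pairs that represent the tensor
  \<open>\<Delta>(h)\<close>; in Sweedler notation, \<open>s\<close> is \<open>\<Sum> h\<^sub>(\<^sub>1\<^sub>) \<otimes> h\<^sub>(\<^sub>2\<^sub>)\<close>.
\<close>

definition symmetry ::
  "('h, 'k) hopf_algebra_scheme \<Rightarrow> (complex, 'a, 'm) module_scheme \<Rightarrow> ('h \<Rightarrow> 'a \<Rightarrow> 'a) \<Rightarrow> bool" where
  "symmetry H A \<pi> \<longleftrightarrow>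
     \<pi> \<in> alg_hom H (End_alg A) \<and>
     (\<forall>h\<in>carrier H. \<forall>a\<in>carrier A. \<forall>b\<in>carrier A. \<forall>s\<in>comult H h.
        \<pi> h (a \<otimes>\<^bsub>A\<^esub> b) =
          (\<Oplus>\<^bsub>A\<^esub>p\<in>Poly_Mapping.keys s.
             Poly_Mapping.lookup s p \<odot>\<^bsub>A\<^esub> (\<pi> (fst p) a \<otimes>\<^bsub>A\<^esub> \<pi> (snd p) b))) \<and>
     (\<forall>h\<in>carrier H. \<pi> h \<one>\<^bsub>A\<^esub> = counit H h \<odot>\<^bsub>A\<^esub> \<one>\<^bsub>A\<^esub>)"


section \<open>The quantum disc\<close>

datatype disc_gen = Z | Zstar

definition disc_rels :: "complex \<Rightarrow> (disc_gen list \<Rightarrow>\<^sub>0 complex) set" where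
  "disc_rels q =
     {Poly_Mapping.single [Z, Zstar] 1
        - (Poly_Mapping.single [Zstar, Z] (q\<^sup>2) + Poly_Mapping.single [] (1 - q\<^sup>2))}"

definition Pol_disc :: "complex \<Rightarrow> (complex, (disc_gen list \<Rightarrow>\<^sub>0 complex) set) module" where
  "Pol_disc q = presented_alg (disc_rels q)"

definition disc_grade :: "complex \<Rightarrow> int \<Rightarrow> (disc_gen list \<Rightarrow>\<^sub>0 complex) set set" where
  "disc_grade q k = lin_span (Pol_disc q)
     {gen (disc_rels q) Z [^]\<^bsub>Pol_disc q\<^esub> i \<otimes>\<^bsub>Pol_disc q\<^esub> gen (disc_rels q) Zstar [^]\<^bsub>Pol_disc q\<^esub> j |
        i j :: nat. int i - int j = k}"


section \<open>The quantum universal enveloping algebra of \<open>sl\<^sub>2\<close>\<close>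

datatype uq_gen = UK | UKinv | UE | UF

definition uq_rels :: "complex \<Rightarrow> (uq_gen list \<Rightarrow>\<^sub>0 complex) set" where
  "uq_rels q =
     {Poly_Mapping.single [UKinv, UK] 1 - Poly_Mapping.single [] 1,
      Poly_Mapping.single [UK, UKinv] 1 - Poly_Mapping.single [] 1,
      Poly_Mapping.single [UK, UE] 1 - Poly_Mapping.single [UE, UK] (q\<^sup>2),
      Poly_Mapping.single [UK, UF] 1 - Poly_Mapping.single [UF, UK] (1 / q\<^sup>2),
      (Poly_Mapping.single [UE, UF] 1 - Poly_Mapping.single [UF, UE] 1)
        - (Poly_Mapping.single [UK] (1 / (q - 1 / q)) - Poly_Mapping.single [UKinv] (1 / (q - 1 / q)))}"

definition Uq_alg :: "complex \<Rightarrow> (complex, (uq_gen list \<Rightarrow>\<^sub>0 complex) set) module" where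
  "Uq_alg q = presented_alg (uq_rels q)"

definition Uq_comult ::
  "complex \<Rightarrow> (uq_gen list \<Rightarrow>\<^sub>0 complex) set
     \<Rightarrow> ((uq_gen list \<Rightarrow>\<^sub>0 complex) set \<times> (uq_gen list \<Rightarrow>\<^sub>0 complex) set \<Rightarrow>\<^sub>0 complex) set" where
  "Uq_comult q =
    (let U = Uq_alg q; x = gen (uq_rels q); T = tensor_alg U U; t = tensor_elt U U in
     hom_on_gens (uq_rels q) T
       (\<lambda>g. case g of
          UK \<Rightarrow> t (x UK) (x UK)
        | UKinv \<Rightarrow> t (x UKinv) (x UKinv)
        | UE \<Rightarrow> t \<one>\<^bsub>U\<^esub> (x UE) \<oplus>\<^bsub>T\<^esub> t (x UE) (x UK)
        | UF \<Rightarrow> t (x UF) \<one>\<^bsub>U\<^esub> \<oplus>\<^bsub>T\<^esub> t (x UKinv) (x UF)))"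

definition Uq_counit :: "complex \<Rightarrow> (uq_gen list \<Rightarrow>\<^sub>0 complex) set \<Rightarrow> complex" where
  "Uq_counit q = hom_on_gens (uq_rels q) complex_alg
     (\<lambda>g. case g of UK \<Rightarrow> 1 | UKinv \<Rightarrow> 1 | UE \<Rightarrow> 0 | UF \<Rightarrow> 0)"

text \<open>The antipode is an anti-homomorphism, i.e.\ a homomorphism to the opposite algebra.\<close>

definition Uq_antipode ::
  "complex \<Rightarrow> (uq_gen list \<Rightarrow>\<^sub>0 complex) set \<Rightarrow> (uq_gen list \<Rightarrow>\<^sub>0 complex) set" where
  "Uq_antipode q =
    (let U = Uq_alg q; x = gen (uq_rels q) in
     hom_on_gens (uq_rels q) (opposite_alg U)
       (\<lambda>g. case g of
          UK \<Rightarrow> x UKinv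
        | UKinv \<Rightarrow> x UK
        | UE \<Rightarrow> \<ominus>\<^bsub>U\<^esub> (x UE \<otimes>\<^bsub>U\<^esub> x UKinv)
        | UF \<Rightarrow> \<ominus>\<^bsub>U\<^esub> (x UK \<otimes>\<^bsub>U\<^esub> x UF)))"

definition Uq :: "complex \<Rightarrow> (uq_gen list \<Rightarrow>\<^sub>0 complex) set hopf_algebra" where
  "Uq q = module.extend (Uq_alg q)
     (hopf_algebra.fields (Uq_comult q) (Uq_counit q) (Uq_antipode q))"


section \<open>The grading jump\<close>

text \<open>
  The relation ``\<open>n\<close> is the grading jump of \<open>\<pi>\<close>''.  That every symmetry has exactly one grading
  jump is a theorem, on which this definition does not depend.
\<close>

definition grading_jump ::
  "complex \<Rightarrow> ((uq_gen list \<Rightarrow>\<^sub>0 complex) set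
     \<Rightarrow> (disc_gen list \<Rightarrow>\<^sub>0 complex) set \<Rightarrow> (disc_gen list \<Rightarrow>\<^sub>0 complex) set) \<Rightarrow> int \<Rightarrow> bool" where
  "grading_jump q \<pi> n \<longleftrightarrow>
    (let e = \<pi> (gen (uq_rels q) UE); f = \<pi> (gen (uq_rels q) UF); A = Pol_disc q in
     if (\<forall>x\<in>carrier A. e x = \<zero>\<^bsub>A\<^esub>) \<and> (\<forall>x\<in>carrier A. f x = \<zero>\<^bsub>A\<^esub>) then n = 0
     else n \<noteq> 0 \<and>
       (\<forall>k. e ` disc_grade q k \<subseteq> disc_grade q (k + n) \<and>
            f ` disc_grade q k \<subseteq> disc_grade q (k - n)))"

end

(*
  The algebra acts faithfully on functions on the integers by weighted shifts,
    (z phi)(l) = phi(l+1)  and  (z* phi)(l) = (1 - x(l-1)) phi(l-1)  with  x(l) = q^(2l),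
  and a homogeneous element of degree d is a weight times the shift by d, the weight being a
  polynomial in x(l) (times a fixed product of factors 1 - x(l-i) if d < 0).

  Let n = -m be the grading jump, m >= 2.  As e(a) k(b) = e(ab) - a e(b), the automorphism k
  preserves degrees, hence k(z) = alpha z and k(z* ) = z* / alpha, and alpha^m = q^(-2) because
  ke = q^2 ek.  For m >= 2 no power of q^2 equals alpha.  This makes the q-difference equations
  solvable that turn e and f into inner twisted derivations
    e(a) = T k(a) - a T,   f(a) = S a - k^(-1)(a) S
  with weighted shifts T and S of degree -m and m (weights t and s).  Put F(l) = t(l) s(l-m) and
  c(l) = q^(-2) F(l) - F(l+m).  The relation for ef - fe, applied to z, says
    alpha c(l) - c(l+1)/alpha = (alpha - 1/alpha)/(q - 1/q).
  Comparing coefficients, first c is the constant 1/(q - 1/q) and then F is constant.  But t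
  vanishes at l = 1, so F = 0 and c = 0, a contradiction.
*)

theory Submission
  imports Defs "HOL-Computational_Algebra.Polynomial"
begin

section \<open>Complex algebras as records\<close>

text \<open>The bound m \<ge> 2 enters through resonance. On x^i the q-difference operator sending
  g(l) to c g(l) - d g(l+s) is the scalar c - d q^(2si), so solvability and uniqueness both mean
  that such scalars are nonzero. Fitting t to e(w) alone and s to f(z) alone requires \<alpha>
  \<noteq> q^(2i) for i \<ge> 0. That the disc relation then forces the values at the other
  generator requires in addition \<alpha> \<noteq> q^(-2); for m = 1 exactly this value occurs.

  The functions live on all integers because weights are compared far to the left: for l \<le> 0 the
  factors 1 - x(l-i) with i \<ge> 1 are nonzero and can be divided out, and x takes infinitely many
  values there, which determines polynomials in x. The point l = 1 plays the opposite role: there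
  the factor 1 - x(0) vanishes, and every weight of negative degree with it. This is the boundary
  condition that finally fixes F.

  The coproduct is given by a definite description, so it says something about e, f and k only after
  its values on the generators are shown to satisfy the relations.\<close>

locale calg = ring A for A :: "(complex, 'a, 'm) module_scheme" (structure) +
  assumes smult_closed [simp, intro]: "x \<in> carrier A \<Longrightarrow> c \<odot> x \<in> carrier A"
    and smult_add: "x \<in> carrier A \<Longrightarrow> y \<in> carrier A \<Longrightarrow> c \<odot> (x \<oplus> y) = c \<odot> x \<oplus> c \<odot> y"
    and add_smult: "x \<in> carrier A \<Longrightarrow> (c + d) \<odot> x = c \<odot> x \<oplus> d \<odot> x"
    and smult_smult: "x \<in> carrier A \<Longrightarrow> c \<odot> (d \<odot> x) = (c * d) \<odot> x"
    and one_smult: "x \<in> carrier A \<Longrightarrow> 1 \<odot> x = x"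
    and smult_mult: "x \<in> carrier A \<Longrightarrow> y \<in> carrier A \<Longrightarrow> (c \<odot> x) \<otimes> y = c \<odot> (x \<otimes> y)"
    and mult_smult: "x \<in> carrier A \<Longrightarrow> y \<in> carrier A \<Longrightarrow> x \<otimes> (c \<odot> y) = c \<odot> (x \<otimes> y)"
begin

lemma zero_smult: "x \<in> carrier A \<Longrightarrow> 0 \<odot> x = \<zero>"
  using add_smult[of x 0 0] by (simp add: add.r_cancel_one')

lemma smult_zero: "c \<odot> \<zero> = \<zero>"
  using zero_smult[of \<zero>] smult_smult[of \<zero> c 0] by simp

lemma uminus_smult: "x \<in> carrier A \<Longrightarrow> (- c) \<odot> x = \<ominus> (c \<odot> x)"
  using add_smult[of x "- c" c] by (intro minus_equality[symmetric]) (simp_all add: zero_smult)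

lemma a_inv_smult: "x \<in> carrier A \<Longrightarrow> \<ominus> x = (- 1) \<odot> x"
  by (simp add: uminus_smult one_smult)

lemma minus_eq_zero_iff: "x \<in> carrier A \<Longrightarrow> y \<in> carrier A \<Longrightarrow> x \<ominus> y = \<zero> \<longleftrightarrow> x = y"
  by (metis a_minus_def minus_equality minus_minus r_neg add.inv_closed)

lemma add_minus_cancel:
  "x \<in> carrier A \<Longrightarrow> y \<in> carrier A \<Longrightarrow> (x \<oplus> y) \<ominus> x = y"
  by algebra

text \<open>The shape of the commutator of \<Delta>(e) and \<Delta>(f): \<open>a\<close> and
  \<open>x\<close> are cross terms common to both products, \<open>c\<close> and \<open>d\<close>
  contain fe in one tensor factor, and \<open>u\<close>, \<open>v\<close>, \<open>w\<close> arise
  from rewriting ef by its commutator.\<close>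

lemma telescoping_sum:
  assumes "a \<in> carrier A" "c \<in> carrier A" "d \<in> carrier A" "x \<in> carrier A"
    "u \<in> carrier A" "v \<in> carrier A" "w \<in> carrier A"
  shows "(a \<oplus> (c \<oplus> (w \<ominus> u))) \<oplus> ((d \<oplus> (u \<ominus> v)) \<oplus> x) \<ominus> ((a \<oplus> d) \<oplus> (c \<oplus> x)) = w \<ominus> v"
  using assms by algebra

end

lemma alg_homD:
  assumes "h \<in> alg_hom A B"
  shows "x \<in> carrier A \<Longrightarrow> h x \<in> carrier B"
    and "x \<in> carrier A \<Longrightarrow> y \<in> carrier A \<Longrightarrow> h (x \<oplus>\<^bsub>A\<^esub> y) = h x \<oplus>\<^bsub>B\<^esub> h y"
    and "x \<in> carrier A \<Longrightarrow> y \<in> carrier A \<Longrightarrow> h (x \<otimes>\<^bsub>A\<^esub> y) = h x \<otimes>\<^bsub>B\<^esub> h y"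
    and "h \<one>\<^bsub>A\<^esub> = \<one>\<^bsub>B\<^esub>"
    and "x \<in> carrier A \<Longrightarrow> h (c \<odot>\<^bsub>A\<^esub> x) = c \<odot>\<^bsub>B\<^esub> h x"
  using assms by (auto simp: alg_hom_def ring_hom_def)


section \<open>Monoid algebras and their universal property\<close>

lemma monoid_alg_sel [simp]:
  "carrier (monoid_alg M) = {s. Poly_Mapping.keys s \<subseteq> carrier M}"
  "\<one>\<^bsub>monoid_alg M\<^esub> = Poly_Mapping.single \<one>\<^bsub>M\<^esub> 1"
  "\<zero>\<^bsub>monoid_alg M\<^esub> = 0"
  "s \<oplus>\<^bsub>monoid_alg M\<^esub> t = s + t"
  "c \<odot>\<^bsub>monoid_alg M\<^esub> s = Poly_Mapping.map ((*) c) s"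
  by (simp_all add: monoid_alg_def)

lemma monoid_alg_mult:
  "s \<otimes>\<^bsub>monoid_alg M\<^esub> t = (\<Sum>x\<in>Poly_Mapping.keys s. \<Sum>y\<in>Poly_Mapping.keys t.
     Poly_Mapping.single (x \<otimes>\<^bsub>M\<^esub> y) (Poly_Mapping.lookup s x * Poly_Mapping.lookup t y))"
  by (simp add: monoid_alg_def)

lemma monoid_alg_mult_single [simp]:
  "Poly_Mapping.single x a \<otimes>\<^bsub>monoid_alg M\<^esub> Poly_Mapping.single y b
     = Poly_Mapping.single (x \<otimes>\<^bsub>M\<^esub> y) (a * b)"
  by (cases "a = 0"; cases "b = 0") (simp_all add: monoid_alg_mult)

lemma lookup_map_times [simp]:
  "Poly_Mapping.lookup (Poly_Mapping.map ((*) (c::complex)) s) x = c * Poly_Mapping.lookup s x"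
  by (simp add: map.rep_eq when_def)

lemma map_zero_times: "Poly_Mapping.map ((*) (0::complex)) s = 0"
  by (rule poly_mapping_eqI) simp

lemma keys_map_times:
  "Poly_Mapping.keys (Poly_Mapping.map ((*) (c::complex)) s) = (if c = 0 then {} else Poly_Mapping.keys s)"
  by (auto simp: in_keys_iff map_zero_times)

lemma map_times_sum:
  "Poly_Mapping.map ((*) (c::complex)) (\<Sum>i\<in>I. f i) = (\<Sum>i\<in>I. Poly_Mapping.map ((*) c) (f i))"
  by (rule poly_mapping_eqI) (simp add: lookup_sum sum_distrib_left)

lemma calg_monoid_alg:
  assumes "monoid M"
  shows "calg (monoid_alg M)"
proof -
  interpret ring "monoid_alg M" by (rule ring_monoid_alg[OF assms])
  show ?thesis
  proof (unfold_locales, goal_cases)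
    case (6 x y c)
    then show ?case
      by (simp add: monoid_alg_mult map_times_sum keys_map_times map_zero_times)
        (simp add: mult.assoc)
  next
    case (7 x y c)
    then show ?case
      by (simp add: monoid_alg_mult map_times_sum keys_map_times map_zero_times)
        (simp add: mult.left_commute)
  qed (auto simp: keys_map_times lookup_add algebra_simps split: if_splits
      intro!: poly_mapping_eqI)
qed

lemma poly_mapping_linear_induct [consumes 1, case_names zero add]:
  fixes s :: "'m \<Rightarrow>\<^sub>0 complex"
  assumes "Poly_Mapping.keys s \<subseteq> K" "P 0"
    "\<And>x a s. x \<in> K \<Longrightarrow> Poly_Mapping.keys s \<subseteq> K \<Longrightarrow> P s \<Longrightarrow> P (Poly_Mapping.single x a + s)"
  shows "P s"
proof -
  have s: "s = (\<Sum>x\<in>Poly_Mapping.keys s. Poly_Mapping.single x (Poly_Mapping.lookup s x))"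
    by (rule poly_mapping_eqI)
      (auto simp: lookup_sum lookup_single when_def in_keys_iff sum.delta if_distrib cong: if_cong)
  have "Poly_Mapping.keys (\<Sum>x\<in>B. Poly_Mapping.single x (f x)) \<subseteq> K \<and>
      P (\<Sum>x\<in>B. Poly_Mapping.single x (f x))" if "finite B" "B \<subseteq> K" for B f
    using that
  proof (induction B)
    case (insert x B)
    then show ?case
      using keys_add[of "Poly_Mapping.single x (f x)" "\<Sum>x\<in>B. Poly_Mapping.single x (f x)"]
      by (auto intro!: assms(3) split: if_splits)
  qed (auto intro: assms)
  from this[of "Poly_Mapping.keys s" "Poly_Mapping.lookup s"] assms(1) s show ?thesis
    by simp
qed

text \<open>The sum over the support has the same form as the Sweedler sum in
  \<open>symmetry\<close>, so one notion serves both the universal property of free algebras and the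
  evaluation of coproducts.\<close>

definition lin_ext ::
  "(complex, 'b, 'n) module_scheme \<Rightarrow> ('m \<Rightarrow> 'b) \<Rightarrow> ('m \<Rightarrow>\<^sub>0 complex) \<Rightarrow> 'b" where
  "lin_ext B \<psi> s = (\<Oplus>\<^bsub>B\<^esub>x\<in>Poly_Mapping.keys s. Poly_Mapping.lookup s x \<odot>\<^bsub>B\<^esub> \<psi> x)"

context calg
begin

lemma lin_ext_superset:
  assumes "finite S" "Poly_Mapping.keys s \<subseteq> S" "\<psi> \<in> S \<rightarrow> carrier A"
  shows "lin_ext A \<psi> s = (\<Oplus>x\<in>S. Poly_Mapping.lookup s x \<odot> \<psi> x)"
  unfolding lin_ext_def using assms
  by (intro add.finprod_mono_neutral_cong_left) (auto simp: in_keys_iff zero_smult Pi_def)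

lemma lin_ext_closed [simp]:
  "\<psi> \<in> K \<rightarrow> carrier A \<Longrightarrow> Poly_Mapping.keys s \<subseteq> K \<Longrightarrow> lin_ext A \<psi> s \<in> carrier A"
  unfolding lin_ext_def by (intro finsum_closed) (auto simp: Pi_def)

lemma lin_ext_zero [simp]: "lin_ext A \<psi> 0 = \<zero>"
  by (simp add: lin_ext_def)

lemma lin_ext_single [simp]: "\<psi> x \<in> carrier A \<Longrightarrow> lin_ext A \<psi> (Poly_Mapping.single x c) = c \<odot> \<psi> x"
  by (cases "c = 0") (simp_all add: lin_ext_def zero_smult)

lemma lin_ext_add:
  assumes "\<psi> \<in> K \<rightarrow> carrier A" "Poly_Mapping.keys s \<subseteq> K" "Poly_Mapping.keys t \<subseteq> K"
  shows "lin_ext A \<psi> (s + t) = lin_ext A \<psi> s \<oplus> lin_ext A \<psi> t"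
proof -
  let ?S = "Poly_Mapping.keys s \<union> Poly_Mapping.keys t"
  have "\<psi> \<in> ?S \<rightarrow> carrier A" using assms by auto
  then show ?thesis
    using Poly_Mapping.keys_add[of s t]
    by (subst (1 2 3) lin_ext_superset[of ?S])
      (auto simp: lookup_add add_smult Pi_def intro!: trans[OF finsum_cong' finsum_addf])
qed

lemma lin_ext_map_times:
  assumes "\<psi> \<in> K \<rightarrow> carrier A" "Poly_Mapping.keys s \<subseteq> K"
  shows "lin_ext A \<psi> (Poly_Mapping.map ((*) c) s) = c \<odot> lin_ext A \<psi> s"
  using assms(2)
proof (induction rule: poly_mapping_linear_induct)
  case zero
  have "Poly_Mapping.map ((*) c) (0 :: 'b \<Rightarrow>\<^sub>0 complex) = 0"
    by (rule poly_mapping_eqI) simp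
  then show ?case by (simp add: smult_zero)
next
  case (add x a s)
  have "Poly_Mapping.map ((*) c) (Poly_Mapping.single x a + s)
      = Poly_Mapping.single x (c * a) + Poly_Mapping.map ((*) c) s"
    by (rule poly_mapping_eqI) (simp add: lookup_add algebra_simps lookup_single when_def)
  then show ?case
    using add assms(1)
    by (auto simp: lin_ext_add[OF assms(1)] keys_map_times smult_add smult_smult Pi_def
        lin_ext_closed[OF assms(1)])
qed

text \<open>Both sides of the product rule are bilinear, so it spreads from basis elements first to
  the right factor and then to the left one.\<close>

lemma lin_ext_alg_hom:
  assumes "monoid M" and \<psi>: "\<psi> \<in> carrier M \<rightarrow> carrier A" and "\<psi> \<one>\<^bsub>M\<^esub> = \<one>"
    and mult: "\<And>x y. x \<in> carrier M \<Longrightarrow> y \<in> carrier M \<Longrightarrow> \<psi> (x \<otimes>\<^bsub>M\<^esub> y) = \<psi> x \<otimes> \<psi> y"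
  shows "lin_ext A \<psi> \<in> alg_hom (monoid_alg M) A"
proof -
  interpret F: calg "monoid_alg M" by (rule calg_monoid_alg[OF assms(1)])
  interpret M: Group.monoid M by fact
  have sgl: "Poly_Mapping.single x c \<in> carrier (monoid_alg M)" if "x \<in> carrier M" for x c
    using that by simp
  have dl: "(s + s') \<otimes>\<^bsub>monoid_alg M\<^esub> t = s \<otimes>\<^bsub>monoid_alg M\<^esub> t + s' \<otimes>\<^bsub>monoid_alg M\<^esub> t"
    if "Poly_Mapping.keys s \<subseteq> carrier M" "Poly_Mapping.keys s' \<subseteq> carrier M" "Poly_Mapping.keys t \<subseteq> carrier M" for s s' t
    using F.l_distr[of s s' t] that by simp
  have dr: "s \<otimes>\<^bsub>monoid_alg M\<^esub> (t + t') = s \<otimes>\<^bsub>monoid_alg M\<^esub> t + s \<otimes>\<^bsub>monoid_alg M\<^esub> t'"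
    if "Poly_Mapping.keys s \<subseteq> carrier M" "Poly_Mapping.keys t \<subseteq> carrier M" "Poly_Mapping.keys t' \<subseteq> carrier M" for s t t'
    using F.r_distr[of t t' s] that by simp
  have cl: "Poly_Mapping.keys (s \<otimes>\<^bsub>monoid_alg M\<^esub> t) \<subseteq> carrier M"
    if "Poly_Mapping.keys s \<subseteq> carrier M" "Poly_Mapping.keys t \<subseteq> carrier M" for s t
    using F.m_closed[of s t] that by simp
  note ad = lin_ext_add[OF \<psi>]
  note lc = lin_ext_closed[OF \<psi>]
  have c: "\<psi> x \<in> carrier A" if "x \<in> carrier M" for x using that \<psi> by auto
  have 1: "lin_ext A \<psi> (Poly_Mapping.single x a \<otimes>\<^bsub>monoid_alg M\<^esub> t)
      = lin_ext A \<psi> (Poly_Mapping.single x a) \<otimes> lin_ext A \<psi> t"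
    if "Poly_Mapping.keys t \<subseteq> carrier M" "x \<in> carrier M" for x a t
    using that
  proof (induction rule: poly_mapping_linear_induct)
    case zero
    then show ?case by (simp add: monoid_alg_mult c)
  next
    case (add y b t)
    then show ?case
      by (subst dr) (auto simp: ad cl lc c mult r_distr smult_mult mult_smult smult_smult mult.commute)
  qed
  have 2: "lin_ext A \<psi> (s \<otimes>\<^bsub>monoid_alg M\<^esub> t) = lin_ext A \<psi> s \<otimes> lin_ext A \<psi> t"
    if "Poly_Mapping.keys s \<subseteq> carrier M" "Poly_Mapping.keys t \<subseteq> carrier M" for s t
    using that
  proof (induction rule: poly_mapping_linear_induct)
    case zero
    then show ?case by (simp add: monoid_alg_mult lc)
  next
    case (add y b s)
    then show ?case
      by (subst dl) (auto simp: ad cl lc c 1 l_distr)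
  qed
  show ?thesis
    unfolding alg_hom_def using assms(3)
    by (auto intro!: ring_hom_memI simp: lc 2 ad lin_ext_map_times[OF \<psi>] one_smult)
qed

end


section \<open>Quotient algebras\<close>

text \<open>\<open>quotient_alg A I\<close> is a larger record than \<open>A Quot I\<close> with the
  same ring fields; this carries the ring structure across.\<close>

lemma ring_cong:
  assumes "ring R" "carrier S = carrier R" "monoid.mult S = monoid.mult R" "one S = one R"
    "zero S = zero R" "add S = add R"
  shows "ring S"
proof -
  interpret ring R by fact
  show ?thesis
  proof (rule ringI)
    show "abelian_group S"
      by (rule abelian_groupI) (use assms(2-) a_assoc a_comm l_neg in \<open>auto intro: bexI[of _ "a_inv R _"]\<close>)
    show "Group.monoid S"
      by (rule monoidI) (use assms(2-) m_assoc in auto)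
  qed (use assms(2-) l_distr r_distr in auto)
qed

lemma quotient_alg_sel:
  "carrier (quotient_alg A I) = a_rcosets\<^bsub>A\<^esub> I"
  "monoid.mult (quotient_alg A I) = rcoset_mult A I"
  "one (quotient_alg A I) = I +>\<^bsub>A\<^esub> \<one>\<^bsub>A\<^esub>"
  "zero (quotient_alg A I) = I"
  "add (quotient_alg A I) = set_add A"
  "c \<odot>\<^bsub>quotient_alg A I\<^esub> X = (\<Union>x\<in>X. I +>\<^bsub>A\<^esub> (c \<odot>\<^bsub>A\<^esub> x))"
  by (simp_all add: quotient_alg_def FactRing_def ring.extend_def module.fields_def)

locale calg_ideal = calg A + ideal I A for I and A (structure)
begin

abbreviation "Q \<equiv> quotient_alg A I"

lemma quot_carrier: "carrier Q = (\<lambda>x. I +> x) ` carrier A"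
  by (auto simp: quotient_alg_sel A_RCOSETS_def')

lemma quot_closed [simp]: "x \<in> carrier A \<Longrightarrow> I +> x \<in> carrier Q"
  by (simp add: quot_carrier)

lemma quot_mult: "x \<in> carrier A \<Longrightarrow> y \<in> carrier A \<Longrightarrow> (I +> x) \<otimes>\<^bsub>Q\<^esub> (I +> y) = I +> (x \<otimes> y)"
  by (simp add: quotient_alg_sel rcoset_mult_add)

lemma quot_add: "x \<in> carrier A \<Longrightarrow> y \<in> carrier A \<Longrightarrow> (I +> x) \<oplus>\<^bsub>Q\<^esub> (I +> y) = I +> (x \<oplus> y)"
  by (simp add: quotient_alg_sel a_rcos_sum)

lemma quot_eq_iff:
  assumes "x \<in> carrier A" "y \<in> carrier A"
  shows "I +> x = I +> y \<longleftrightarrow> x \<ominus> y \<in> I"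
  using assms a_rcos_module_minus[OF ring_axioms assms(2,1)]
  by (metis a_repr_independence' a_repr_independenceD)

text \<open>As c x = (c 1) x, an ideal of a unital algebra is automatically a subspace.\<close>

lemma ideal_smult: "x \<in> I \<Longrightarrow> c \<odot> x \<in> I"
  using I_l_closed[of x "c \<odot> \<one>"] by (simp add: smult_mult)

text \<open>The scalar multiple of a coset is a union over all representatives; since the ideal is
  stable under scalars, all cosets in that union coincide.\<close>

lemma quot_smult:
  assumes "x \<in> carrier A"
  shows "c \<odot>\<^bsub>Q\<^esub> (I +> x) = I +> (c \<odot> x)"
proof -
  have "I +> (c \<odot> y) = I +> (c \<odot> x)" if "y \<in> I +> x" for y
  proof -
    have y: "y \<in> carrier A" using that assms a_elemrcos_carrier by blast
    have "y \<ominus> x \<in> I" using that a_rcos_module_minus[OF ring_axioms assms y] by simp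
    then have "c \<odot> (y \<ominus> x) \<in> I" by (rule ideal_smult)
    moreover have "c \<odot> (y \<ominus> x) = c \<odot> y \<ominus> c \<odot> x"
      using y assms by (simp add: minus_eq smult_add a_inv_smult smult_smult)
    ultimately show ?thesis using quot_eq_iff y assms by simp
  qed
  moreover have "x \<in> I +> x" using assms by (rule a_rcos_self)
  ultimately show ?thesis unfolding quotient_alg_sel by blast
qed

lemma quot_one: "\<one>\<^bsub>Q\<^esub> = I +> \<one>"
  by (simp add: quotient_alg_sel)

lemma calg_quotient: "calg Q"
proof -
  interpret Q: ring Q
    by (rule ring_cong[OF quotient_is_ring]) (simp_all add: quotient_alg_sel FactRing_def)
  show ?thesis
    by unfold_locales
      (auto simp: quot_carrier quot_smult quot_add quot_mult smult_add add_smult smult_smult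
        one_smult smult_mult mult_smult)
qed

lemma quotient_alg_hom_exists:
  assumes "calg B" "h \<in> alg_hom A B" "\<And>x. x \<in> I \<Longrightarrow> h x = \<zero>\<^bsub>B\<^esub>"
  shows "\<exists>h'. h' \<in> alg_hom Q B \<and> h' \<in> extensional (carrier Q) \<and>
    (\<forall>x\<in>carrier A. h' (I +> x) = h x)"
proof -
  interpret B: calg B by fact
  note h = alg_homD[OF assms(2)]
  have eq: "h x = h y" if "x \<in> carrier A" "y \<in> carrier A" "I +> x = I +> y" for x y
  proof -
    have "x \<ominus> y \<in> I" using that quot_eq_iff by simp
    from assms(3)[OF this] that have "h x \<oplus>\<^bsub>B\<^esub> (- 1) \<odot>\<^bsub>B\<^esub> h y = \<zero>\<^bsub>B\<^esub>"
      by (simp add: minus_eq a_inv_smult h)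
    then show ?thesis
      using that h by (metis B.a_inv_smult B.add.inv_closed B.minus_equality B.minus_minus)
  qed
  define h' where "h' = (\<lambda>X\<in>carrier Q. h (SOME x. x \<in> carrier A \<and> X = I +> x))"
  have *: "h' (I +> x) = h x" if "x \<in> carrier A" for x
  proof -
    have "\<exists>y. y \<in> carrier A \<and> I +> x = I +> y" using that by auto
    from someI_ex[OF this] eq[OF that, of "SOME y. y \<in> carrier A \<and> I +> x = I +> y"] that
    show ?thesis unfolding h'_def by simp
  qed
  have "h' \<in> alg_hom Q B"
    unfolding alg_hom_def
    by (auto intro!: ring_hom_memI simp: quot_carrier quot_smult quot_add quot_mult quot_one * h)
  moreover have "h' \<in> extensional (carrier Q)" by (simp add: h'_def)
  ultimately show ?thesis using * by auto
qed

end

section \<open>Algebras given by generators and relations\<close>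

lemma alg_hom_minus:
  assumes "calg A" "calg B" "h \<in> alg_hom A B" "x \<in> carrier A" "y \<in> carrier A"
  shows "h (x \<ominus>\<^bsub>A\<^esub> y) = h x \<ominus>\<^bsub>B\<^esub> h y"
proof -
  interpret A: calg A by fact
  interpret B: calg B by fact
  show ?thesis using assms(4,5)
    by (simp add: a_minus_def A.a_inv_smult B.a_inv_smult alg_homD[OF assms(3)])
qed

lemma monoid_word_monoid: "monoid word_monoid"
  by (rule monoidI) (simp_all add: word_monoid_def)

lemma word_monoid_sel [simp]:
  "carrier word_monoid = UNIV" "v \<otimes>\<^bsub>word_monoid\<^esub> w = v @ w" "\<one>\<^bsub>word_monoid\<^esub> = []"
  by (simp_all add: word_monoid_def)

interpretation free: calg "free_alg :: (complex, 'g list \<Rightarrow>\<^sub>0 complex) module"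
  by (rule calg_monoid_alg[OF monoid_word_monoid])

lemma free_minus: "s \<ominus>\<^bsub>free_alg\<^esub> t = s - t"
proof -
  have "(s - t) \<oplus>\<^bsub>free_alg\<^esub> t = s" by simp
  then show ?thesis
    by (metis UNIV_I free.add.inv_solve_right' free.minus_eq mem_Collect_eq monoid_alg_sel(1)
        top_greatest word_monoid_sel(1))
qed

lemma alg_hom_free_single:
  assumes "calg B" "h \<in> alg_hom free_alg B" and \<phi>: "\<And>g. h (Poly_Mapping.single [g] 1) = \<phi> g"
  shows "h (Poly_Mapping.single w c) = c \<odot>\<^bsub>B\<^esub> foldr (\<lambda>g y. \<phi> g \<otimes>\<^bsub>B\<^esub> y) w \<one>\<^bsub>B\<^esub>"
proof -
  interpret B: calg B by fact
  note h = alg_homD[OF assms(2), simplified]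
  have "h (Poly_Mapping.single w 1) = foldr (\<lambda>g y. \<phi> g \<otimes>\<^bsub>B\<^esub> y) w \<one>\<^bsub>B\<^esub>"
  proof (induction w)
    case (Cons g w)
    then show ?case
      using h(3)[of "Poly_Mapping.single [g] 1" "Poly_Mapping.single w 1"] by (simp add: \<phi>)
  qed (simp add: h)
  then show ?thesis using h(5)[of c "Poly_Mapping.single w 1"] by simp
qed

lemma alg_hom_free_lin:
  assumes "calg B" "h \<in> alg_hom free_alg B"
  shows "h (s + t) = h s \<oplus>\<^bsub>B\<^esub> h t" and "h (s - t) = h s \<ominus>\<^bsub>B\<^esub> h t"
  using alg_homD(2)[OF assms(2), of s t]
    alg_hom_minus[OF free.calg_axioms assms, of s t]
  by (simp_all add: free_minus)

locale presented =
  fixes R :: "('g list \<Rightarrow>\<^sub>0 complex) set"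
begin

sublocale calg_ideal "Idl\<^bsub>free_alg\<^esub> R" free_alg
  by (intro calg_ideal.intro free.calg_axioms free.genideal_ideal) simp

abbreviation "P \<equiv> presented_alg R"

sublocale P: calg P
  unfolding presented_alg_def by (rule calg_quotient)

abbreviation cls :: "('g list \<Rightarrow>\<^sub>0 complex) \<Rightarrow> ('g list \<Rightarrow>\<^sub>0 complex) set" where
  "cls s \<equiv> Idl\<^bsub>free_alg\<^esub> R +>\<^bsub>free_alg\<^esub> s"

lemma cls_alg_hom: "cls \<in> alg_hom free_alg P"
  unfolding presented_alg_def alg_hom_def
  using quot_mult quot_add quot_smult quot_one quot_closed
  by (auto intro!: ring_hom_memI)

lemma gen_closed [simp]: "gen R g \<in> carrier P"
  using alg_homD(1)[OF cls_alg_hom] by (simp add: gen_def)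

lemma cls_single:
  "cls (Poly_Mapping.single w c) = c \<odot>\<^bsub>P\<^esub> foldr (\<lambda>g y. gen R g \<otimes>\<^bsub>P\<^esub> y) w \<one>\<^bsub>P\<^esub>"
  by (rule alg_hom_free_single[OF P.calg_axioms cls_alg_hom]) (simp add: gen_def)

lemmas cls_lin = alg_hom_free_lin[OF P.calg_axioms cls_alg_hom]

lemma cls_rel: "r \<in> R \<Longrightarrow> cls r = \<zero>\<^bsub>P\<^esub>"
  using free.genideal_self[of R] a_rcos_const[of r]
  by (auto simp: presented_alg_def quotient_alg_sel)

lemma presented_carrier: "carrier P = range cls"
  unfolding presented_alg_def quot_carrier by simp

lemma presented_induct [consumes 1, case_names gen one add smult mult]:
  assumes "x \<in> carrier P" and gen: "\<And>g. \<Phi> (gen R g)" and one: "\<Phi> \<one>\<^bsub>P\<^esub>"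
    and add: "\<And>x y. x \<in> carrier P \<Longrightarrow> y \<in> carrier P \<Longrightarrow> \<Phi> x \<Longrightarrow> \<Phi> y \<Longrightarrow> \<Phi> (x \<oplus>\<^bsub>P\<^esub> y)"
    and smult: "\<And>c x. x \<in> carrier P \<Longrightarrow> \<Phi> x \<Longrightarrow> \<Phi> (c \<odot>\<^bsub>P\<^esub> x)"
    and mult: "\<And>x y. x \<in> carrier P \<Longrightarrow> y \<in> carrier P \<Longrightarrow> \<Phi> x \<Longrightarrow> \<Phi> y \<Longrightarrow> \<Phi> (x \<otimes>\<^bsub>P\<^esub> y)"
  shows "\<Phi> x"
proof -
  have cc: "cls s \<in> carrier P" for s using presented_carrier by simp
  have w: "foldr (\<lambda>g y. gen R g \<otimes>\<^bsub>P\<^esub> y) w \<one>\<^bsub>P\<^esub> \<in> carrier P \<and>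
      \<Phi> (foldr (\<lambda>g y. gen R g \<otimes>\<^bsub>P\<^esub> y) w \<one>\<^bsub>P\<^esub>)" for w
    by (induction w) (auto intro: one mult gen)
  have "\<Phi> (cls s)" for s
  proof -
    have "Poly_Mapping.keys s \<subseteq> UNIV" by simp
    then show ?thesis
    proof (induction s rule: poly_mapping_linear_induct)
      case zero
      have "cls 0 = 0 \<odot>\<^bsub>P\<^esub> \<one>\<^bsub>P\<^esub>"
        using cls_single[of "[]" 0] by simp
      then show ?case using smult[OF _ one, of 0] by simp
    next
      case (add x a s)
      then show ?case
        using w[of x] by (auto simp: cls_lin cls_single intro!: assms(4) smult cc)
    qed
  qed
  then show ?thesis using assms(1) presented_carrier by auto
qed

lemma presented_hom_unique:
  assumes "calg B" "h \<in> alg_hom P B" "h' \<in> alg_hom P B" "\<And>g. h (gen R g) = h' (gen R g)"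
    and "x \<in> carrier P"
  shows "h x = h' x"
  using assms(5)
  by (induction rule: presented_induct)
    (auto simp: assms(4) alg_homD[OF assms(2)] alg_homD[OF assms(3)])

text \<open>The kernel of the extension to words is an ideal containing \<open>R\<close>, hence
  contains the ideal generated by \<open>R\<close>. The hypothesis \<open>rel\<close> speaks of any
  homomorphism with the given generator values, so that relations can be checked by homomorphism
  rules alone.\<close>

lemma presented_hom_exists:
  assumes "calg B" "\<And>g. \<phi> g \<in> carrier B"
    and rel: "\<forall>h\<in>alg_hom free_alg B.
      (\<forall>g. h (Poly_Mapping.single [g] 1) = \<phi> g) \<longrightarrow> (\<forall>r\<in>R. h r = \<zero>\<^bsub>B\<^esub>)"
  shows "\<exists>h. h \<in> alg_hom P B \<and> h \<in> extensional (carrier P) \<and> (\<forall>g. h (gen R g) = \<phi> g)"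
proof -
  interpret B: calg B by fact
  define \<psi> where "\<psi> w = foldr (\<lambda>g y. \<phi> g \<otimes>\<^bsub>B\<^esub> y) w \<one>\<^bsub>B\<^esub>" for w
  have \<psi>c: "\<psi> w \<in> carrier B" for w
    unfolding \<psi>_def by (induction w) (auto simp: assms)
  have \<psi>m: "\<psi> (v @ w) = \<psi> v \<otimes>\<^bsub>B\<^esub> \<psi> w" for v w
    using \<psi>c by (induction v) (auto simp: \<psi>_def assms B.m_assoc)
  have h: "lin_ext B \<psi> \<in> alg_hom free_alg B"
    by (rule B.lin_ext_alg_hom[OF monoid_word_monoid]) (auto simp: \<psi>c \<psi>m, simp add: \<psi>_def)
  have hg: "lin_ext B \<psi> (Poly_Mapping.single [g] 1) = \<phi> g" for g
    by (simp add: \<psi>c B.one_smult) (simp add: \<psi>_def assms)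
  have "lin_ext B \<psi> \<in> ring_hom free_alg B"
    using h unfolding alg_hom_def by blast
  then have "ideal (a_kernel free_alg B (lin_ext B \<psi>)) free_alg"
    by (intro ring_hom_ring.kernel_is_ideal ring_hom_ringI2 free.ring_axioms B.ring_axioms)
  moreover have "R \<subseteq> a_kernel free_alg B (lin_ext B \<psi>)"
    using rel h hg by (simp add: a_kernel_def' subset_iff)
  ultimately have "Idl\<^bsub>free_alg\<^esub> R \<subseteq> a_kernel free_alg B (lin_ext B \<psi>)"
    by (rule free.genideal_minimal)
  then have "lin_ext B \<psi> x = \<zero>\<^bsub>B\<^esub>" if "x \<in> Idl\<^bsub>free_alg\<^esub> R" for x
    using that by (auto simp: a_kernel_def')
  from quotient_alg_hom_exists[OF assms(1) h this] obtain h' where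
    "h' \<in> alg_hom P B" "h' \<in> extensional (carrier P)" "\<forall>x\<in>carrier free_alg. h' (cls x) = lin_ext B \<psi> x"
    unfolding presented_alg_def by blast
  then show ?thesis using hg by (intro exI[of _ h']) (simp add: gen_def)
qed

text \<open>Resolves the definite description: generation gives agreement on the carrier, and
  extensionality fixes the values outside it.\<close>

lemma hom_on_gens:
  assumes "calg B" "\<And>g. \<phi> g \<in> carrier B"
    and rel: "\<forall>h\<in>alg_hom free_alg B.
      (\<forall>g. h (Poly_Mapping.single [g] 1) = \<phi> g) \<longrightarrow> (\<forall>r\<in>R. h r = \<zero>\<^bsub>B\<^esub>)"
  shows "hom_on_gens R B \<phi> \<in> alg_hom P B" and "hom_on_gens R B \<phi> (gen R g) = \<phi> g"
proof -
  have "\<exists>!h. h \<in> alg_hom P B \<and> h \<in> extensional (carrier P) \<and> (\<forall>g. h (gen R g) = \<phi> g)"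
  proof (rule ex_ex1I)
    show "\<exists>h. h \<in> alg_hom P B \<and> h \<in> extensional (carrier P) \<and> (\<forall>g. h (gen R g) = \<phi> g)"
      by (rule presented_hom_exists[OF assms(1,2) rel])
  next
    fix h h'
    assume "h \<in> alg_hom P B \<and> h \<in> extensional (carrier P) \<and> (\<forall>g. h (gen R g) = \<phi> g)"
      "h' \<in> alg_hom P B \<and> h' \<in> extensional (carrier P) \<and> (\<forall>g. h' (gen R g) = \<phi> g)"
    then show "h = h'"
      using presented_hom_unique[OF assms(1), of h h'] by (intro extensionalityI) auto
  qed
  from theI'[OF this] show "hom_on_gens R B \<phi> \<in> alg_hom P B" "hom_on_gens R B \<phi> (gen R g) = \<phi> g"
    by (auto simp: hom_on_gens_def)
qed

end


section \<open>Tensor products\<close>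

locale calg_pair = A: calg A + B: calg B
  for A :: "(complex, 'a) module" and B :: "(complex, 'b) module"
begin

abbreviation "FT \<equiv> monoid_alg (A \<times>\<times> B)"
abbreviation "IT \<equiv> Idl\<^bsub>FT\<^esub> (bilinear_relators A B)"
abbreviation "TT \<equiv> tensor_alg A B"
abbreviation "tt \<equiv> tensor_elt A B"

lemma DirProd_sel [simp]:
  "carrier (A \<times>\<times> B) = carrier A \<times> carrier B" "\<one>\<^bsub>A \<times>\<times> B\<^esub> = (\<one>\<^bsub>A\<^esub>, \<one>\<^bsub>B\<^esub>)"
  "(a, b) \<otimes>\<^bsub>A \<times>\<times> B\<^esub> (a', b') = (a \<otimes>\<^bsub>A\<^esub> a', b \<otimes>\<^bsub>B\<^esub> b')"
  by (simp_all add: DirProd_def)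

sublocale FT: calg FT
  by (intro calg_monoid_alg DirProd_monoid A.monoid_axioms B.monoid_axioms)

lemma keys_minus_subset:
  "Poly_Mapping.keys s \<subseteq> K \<Longrightarrow> Poly_Mapping.keys t \<subseteq> K \<Longrightarrow> Poly_Mapping.keys (s - t) \<subseteq> K"
  using keys_diff[of s t] by blast

lemma relators_closed: "bilinear_relators A B \<subseteq> carrier FT"
proof
  fix r assume "r \<in> bilinear_relators A B"
  then show "r \<in> carrier FT"
    unfolding bilinear_relators_def
    by (elim UnE CollectE exE conjE) (simp_all add: keys_minus_subset)
qed

sublocale IT: calg_ideal IT FT
  by (intro calg_ideal.intro FT.calg_axioms FT.genideal_ideal relators_closed)

sublocale TT: calg TT
  unfolding tensor_alg_def by (rule IT.calg_quotient)

lemma FT_minus: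
  assumes "s \<in> carrier FT" "t \<in> carrier FT"
  shows "s \<ominus>\<^bsub>FT\<^esub> t = s - t"
proof -
  have "s - t \<in> carrier FT" using assms by (simp add: keys_minus_subset)
  moreover have "(s - t) \<oplus>\<^bsub>FT\<^esub> t = s" by simp
  ultimately show ?thesis
    using assms by (metis FT.add.inv_solve_right FT.minus_eq)
qed

lemma tt_eqI:
  assumes "s \<in> carrier FT" "t \<in> carrier FT" "s - t \<in> bilinear_relators A B"
  shows "IT +>\<^bsub>FT\<^esub> s = IT +>\<^bsub>FT\<^esub> t"
  using assms FT.genideal_self[OF relators_closed] FT_minus[OF assms(1,2)]
  by (simp add: IT.quot_eq_iff del: monoid_alg_sel) blast

lemma tt_closed [simp]: "x \<in> carrier A \<Longrightarrow> y \<in> carrier B \<Longrightarrow> tt x y \<in> carrier TT"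
  unfolding tensor_alg_def tensor_elt_def by (rule IT.quot_closed) simp

lemma tt_mult:
  assumes "x \<in> carrier A" "y \<in> carrier B" "x' \<in> carrier A" "y' \<in> carrier B"
  shows "tt x y \<otimes>\<^bsub>TT\<^esub> tt x' y' = tt (x \<otimes>\<^bsub>A\<^esub> x') (y \<otimes>\<^bsub>B\<^esub> y')"
  using assms unfolding tensor_alg_def tensor_elt_def by (subst IT.quot_mult) simp_all

lemma tt_one: "\<one>\<^bsub>TT\<^esub> = tt \<one>\<^bsub>A\<^esub> \<one>\<^bsub>B\<^esub>"
  unfolding tensor_alg_def tensor_elt_def IT.quot_one by simp

lemma tt_add_left:
  assumes "x \<in> carrier A" "x' \<in> carrier A" "y \<in> carrier B"
  shows "tt (x \<oplus>\<^bsub>A\<^esub> x') y = tt x y \<oplus>\<^bsub>TT\<^esub> tt x' y"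
proof -
  let ?s = "Poly_Mapping.single (x, y) (1::complex) + Poly_Mapping.single (x', y) 1"
  have "?s \<in> carrier FT"
    using assms FT.a_closed[of "Poly_Mapping.single (x, y) 1" "Poly_Mapping.single (x', y) 1"] by simp
  then have "tt (x \<oplus>\<^bsub>A\<^esub> x') y = IT +>\<^bsub>FT\<^esub> ?s"
    unfolding tensor_elt_def using assms
    by (intro tt_eqI) (auto simp: bilinear_relators_def diff_diff_eq)
  then show ?thesis
    unfolding tensor_alg_def tensor_elt_def using assms by (subst IT.quot_add) simp_all
qed

lemma tt_add_right:
  assumes "x \<in> carrier A" "y \<in> carrier B" "y' \<in> carrier B"
  shows "tt x (y \<oplus>\<^bsub>B\<^esub> y') = tt x y \<oplus>\<^bsub>TT\<^esub> tt x y'"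
proof -
  let ?s = "Poly_Mapping.single (x, y) (1::complex) + Poly_Mapping.single (x, y') 1"
  have "?s \<in> carrier FT"
    using assms FT.a_closed[of "Poly_Mapping.single (x, y) 1" "Poly_Mapping.single (x, y') 1"] by simp
  then have "tt x (y \<oplus>\<^bsub>B\<^esub> y') = IT +>\<^bsub>FT\<^esub> ?s"
    unfolding tensor_elt_def using assms
    by (intro tt_eqI) (auto simp: bilinear_relators_def diff_diff_eq)
  then show ?thesis
    unfolding tensor_alg_def tensor_elt_def using assms by (subst IT.quot_add) simp_all
qed

lemma tt_smult:
  assumes "x \<in> carrier A" "y \<in> carrier B"
  shows "tt (c \<odot>\<^bsub>A\<^esub> x) y = c \<odot>\<^bsub>TT\<^esub> tt x y" and "tt x (c \<odot>\<^bsub>B\<^esub> y) = c \<odot>\<^bsub>TT\<^esub> tt x y"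
proof -
  have "c \<odot>\<^bsub>TT\<^esub> tt x y = IT +>\<^bsub>FT\<^esub> Poly_Mapping.single (x, y) c"
    unfolding tensor_alg_def tensor_elt_def using assms by (subst IT.quot_smult) simp_all
  moreover have "tt (c \<odot>\<^bsub>A\<^esub> x) y = IT +>\<^bsub>FT\<^esub> Poly_Mapping.single (x, y) c"
    unfolding tensor_elt_def using assms
    by (intro tt_eqI) (auto simp: bilinear_relators_def)
  moreover have "tt x (c \<odot>\<^bsub>B\<^esub> y) = IT +>\<^bsub>FT\<^esub> Poly_Mapping.single (x, y) c"
    unfolding tensor_elt_def using assms
    by (intro tt_eqI) (auto simp: bilinear_relators_def)
  ultimately show "tt (c \<odot>\<^bsub>A\<^esub> x) y = c \<odot>\<^bsub>TT\<^esub> tt x y" "tt x (c \<odot>\<^bsub>B\<^esub> y) = c \<odot>\<^bsub>TT\<^esub> tt x y"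
    by simp_all
qed

lemma tt_minus_left:
  assumes "x \<in> carrier A" "x' \<in> carrier A" "y \<in> carrier B"
  shows "tt (x \<ominus>\<^bsub>A\<^esub> x') y = tt x y \<ominus>\<^bsub>TT\<^esub> tt x' y"
  using assms by (simp add: a_minus_def A.a_inv_smult TT.a_inv_smult tt_add_left tt_smult)

lemma tt_minus_right:
  assumes "x \<in> carrier A" "y \<in> carrier B" "y' \<in> carrier B"
  shows "tt x (y \<ominus>\<^bsub>B\<^esub> y') = tt x y \<ominus>\<^bsub>TT\<^esub> tt x y'"
  using assms by (simp add: a_minus_def B.a_inv_smult TT.a_inv_smult tt_add_right tt_smult)

end

section \<open>The coproduct on the generators and the resulting twisted Leibniz rules\<close>

lemma uq_rels_iff:
  assumes "calg B" "h \<in> alg_hom free_alg B" "\<And>g. h (Poly_Mapping.single [g] 1) = \<phi> g"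
  shows "(\<forall>r\<in>uq_rels q. h r = \<zero>\<^bsub>B\<^esub>) \<longleftrightarrow>
    \<phi> UKinv \<otimes>\<^bsub>B\<^esub> \<phi> UK = \<one>\<^bsub>B\<^esub> \<and> \<phi> UK \<otimes>\<^bsub>B\<^esub> \<phi> UKinv = \<one>\<^bsub>B\<^esub> \<and>
    \<phi> UK \<otimes>\<^bsub>B\<^esub> \<phi> UE = q\<^sup>2 \<odot>\<^bsub>B\<^esub> (\<phi> UE \<otimes>\<^bsub>B\<^esub> \<phi> UK) \<and>
    \<phi> UK \<otimes>\<^bsub>B\<^esub> \<phi> UF = (1 / q\<^sup>2) \<odot>\<^bsub>B\<^esub> (\<phi> UF \<otimes>\<^bsub>B\<^esub> \<phi> UK) \<and>
    \<phi> UE \<otimes>\<^bsub>B\<^esub> \<phi> UF \<ominus>\<^bsub>B\<^esub> \<phi> UF \<otimes>\<^bsub>B\<^esub> \<phi> UE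
      = (1 / (q - 1 / q)) \<odot>\<^bsub>B\<^esub> \<phi> UK \<ominus>\<^bsub>B\<^esub> (1 / (q - 1 / q)) \<odot>\<^bsub>B\<^esub> \<phi> UKinv"
proof -
  interpret B: calg B by fact
  have [simp]: "\<phi> g \<in> carrier B" for g
    using alg_homD(1)[OF assms(2), of "Poly_Mapping.single [g] 1"] assms(3)[of g] by simp
  show ?thesis
    by (simp add: uq_rels_def alg_hom_free_lin[OF assms(1,2)] alg_hom_free_single[OF assms]
        B.one_smult B.minus_eq_zero_iff)
qed

locale uq = presented "uq_rels q" for q :: complex +
  assumes q: "q \<noteq> 0"
begin

abbreviation "K \<equiv> gen (uq_rels q) UK"
abbreviation "Ki \<equiv> gen (uq_rels q) UKinv"
abbreviation "E \<equiv> gen (uq_rels q) UE"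
abbreviation "F \<equiv> gen (uq_rels q) UF"
abbreviation "\<kappa> \<equiv> 1 / (q - 1 / q)"

lemma uq_relations:
  "Ki \<otimes>\<^bsub>P\<^esub> K = \<one>\<^bsub>P\<^esub>" "K \<otimes>\<^bsub>P\<^esub> Ki = \<one>\<^bsub>P\<^esub>" "K \<otimes>\<^bsub>P\<^esub> E = q\<^sup>2 \<odot>\<^bsub>P\<^esub> (E \<otimes>\<^bsub>P\<^esub> K)"
  "K \<otimes>\<^bsub>P\<^esub> F = (1 / q\<^sup>2) \<odot>\<^bsub>P\<^esub> (F \<otimes>\<^bsub>P\<^esub> K)"
  "E \<otimes>\<^bsub>P\<^esub> F \<ominus>\<^bsub>P\<^esub> F \<otimes>\<^bsub>P\<^esub> E = \<kappa> \<odot>\<^bsub>P\<^esub> K \<ominus>\<^bsub>P\<^esub> \<kappa> \<odot>\<^bsub>P\<^esub> Ki"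
  using uq_rels_iff[OF P.calg_axioms cls_alg_hom, of "gen (uq_rels q)" q] cls_rel
  by (simp_all add: gen_def)

text \<open>This is ke = q^2 ek multiplied by the inverse of k on both sides.\<close>

lemma Ki_E: "Ki \<otimes>\<^bsub>P\<^esub> E = (1 / q\<^sup>2) \<odot>\<^bsub>P\<^esub> (E \<otimes>\<^bsub>P\<^esub> Ki)"
proof -
  have "E \<otimes>\<^bsub>P\<^esub> Ki = Ki \<otimes>\<^bsub>P\<^esub> (K \<otimes>\<^bsub>P\<^esub> E) \<otimes>\<^bsub>P\<^esub> Ki"
    by (simp add: P.m_assoc[symmetric] uq_relations(1))
  also have "\<dots> = q\<^sup>2 \<odot>\<^bsub>P\<^esub> (Ki \<otimes>\<^bsub>P\<^esub> E)"
    by (simp add: uq_relations(3) P.smult_mult P.mult_smult P.m_assoc uq_relations(2))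
  finally show ?thesis using q by (simp add: P.smult_smult P.one_smult)
qed

lemma EF_eq: "E \<otimes>\<^bsub>P\<^esub> F = F \<otimes>\<^bsub>P\<^esub> E \<oplus>\<^bsub>P\<^esub> (\<kappa> \<odot>\<^bsub>P\<^esub> K \<ominus>\<^bsub>P\<^esub> \<kappa> \<odot>\<^bsub>P\<^esub> Ki)"
proof -
  have "E \<otimes>\<^bsub>P\<^esub> F = F \<otimes>\<^bsub>P\<^esub> E \<oplus>\<^bsub>P\<^esub> (E \<otimes>\<^bsub>P\<^esub> F \<ominus>\<^bsub>P\<^esub> F \<otimes>\<^bsub>P\<^esub> E)"
    using gen_closed[of UE] gen_closed[of UF] by algebra
  then show ?thesis by (simp only: uq_relations(5))
qed

sublocale PP: calg_pair P P
  by unfold_locales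

abbreviation "TT \<equiv> PP.TT"
abbreviation "tt \<equiv> PP.tt"

fun comult_gen where
  "comult_gen UK = tt K K"
| "comult_gen UKinv = tt Ki Ki"
| "comult_gen UE = tt \<one>\<^bsub>P\<^esub> E \<oplus>\<^bsub>TT\<^esub> tt E K"
| "comult_gen UF = tt F \<one>\<^bsub>P\<^esub> \<oplus>\<^bsub>TT\<^esub> tt Ki F"

lemma comult_gen_closed: "comult_gen g \<in> carrier TT"
  by (cases g) auto

text \<open>The cross terms e k^(-1) \<otimes> kf and k^(-1) e \<otimes> fk agree, because moving k
  past f and k^(-1) past e yields the same factor q^(-2). Rewriting ef in either tensor factor
  produces \<kappa> k^(-1) \<otimes> k, once with each sign.\<close>

lemma comult_gen_relation:
  "comult_gen UE \<otimes>\<^bsub>TT\<^esub> comult_gen UF \<ominus>\<^bsub>TT\<^esub> comult_gen UF \<otimes>\<^bsub>TT\<^esub> comult_gen UE =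
    \<kappa> \<odot>\<^bsub>TT\<^esub> comult_gen UK \<ominus>\<^bsub>TT\<^esub> \<kappa> \<odot>\<^bsub>TT\<^esub> comult_gen UKinv"
proof -
  let ?a = "tt F E" and ?c = "tt (F \<otimes>\<^bsub>P\<^esub> E) K" and ?d = "tt Ki (F \<otimes>\<^bsub>P\<^esub> E)"
    and ?x = "(1 / q\<^sup>2) \<odot>\<^bsub>TT\<^esub> tt (E \<otimes>\<^bsub>P\<^esub> Ki) (F \<otimes>\<^bsub>P\<^esub> K)"
  let ?u = "\<kappa> \<odot>\<^bsub>TT\<^esub> tt Ki K" and ?v = "\<kappa> \<odot>\<^bsub>TT\<^esub> tt Ki Ki" and ?w = "\<kappa> \<odot>\<^bsub>TT\<^esub> tt K K"
  note s = PP.TT.l_distr PP.TT.r_distr PP.tt_mult PP.tt_smult PP.tt_add_left PP.tt_add_right PP.tt_minus_left PP.tt_minus_right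
  have 1: "comult_gen UE \<otimes>\<^bsub>TT\<^esub> comult_gen UF =
     (?a \<oplus>\<^bsub>TT\<^esub> (?c \<oplus>\<^bsub>TT\<^esub> (?w \<ominus>\<^bsub>TT\<^esub> ?u))) \<oplus>\<^bsub>TT\<^esub> ((?d \<oplus>\<^bsub>TT\<^esub> (?u \<ominus>\<^bsub>TT\<^esub> ?v)) \<oplus>\<^bsub>TT\<^esub> ?x)"
    by (simp add: s uq_relations(4) EF_eq)
  have 2: "comult_gen UF \<otimes>\<^bsub>TT\<^esub> comult_gen UE =
     (?a \<oplus>\<^bsub>TT\<^esub> ?d) \<oplus>\<^bsub>TT\<^esub> (?c \<oplus>\<^bsub>TT\<^esub> ?x)"
    by (simp add: s Ki_E)
  have "comult_gen UE \<otimes>\<^bsub>TT\<^esub> comult_gen UF \<ominus>\<^bsub>TT\<^esub> comult_gen UF \<otimes>\<^bsub>TT\<^esub> comult_gen UE = ?w \<ominus>\<^bsub>TT\<^esub> ?v"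
    unfolding 1 2 by (rule PP.TT.telescoping_sum) simp_all
  then show ?thesis by simp
qed

text \<open>Only this makes the description \<open>Uq_comult\<close> meaningful: the prescribed
  values satisfy all five relations in the tensor square.\<close>

lemma Uq_comult:
  "Uq_comult q \<in> alg_hom P TT" "Uq_comult q (gen (uq_rels q) g) = comult_gen g"
proof -
  have eq: "Uq_comult q = hom_on_gens (uq_rels q) TT comult_gen"
    unfolding Uq_comult_def Let_def Uq_alg_def
    by (rule arg_cong[where f = "hom_on_gens _ _"]) (auto simp: fun_eq_iff split: uq_gen.split)
  note s = PP.TT.l_distr PP.TT.r_distr PP.tt_mult PP.tt_smult PP.tt_one
  have rel: "\<forall>h\<in>alg_hom free_alg TT. (\<forall>g. h (Poly_Mapping.single [g] 1) = comult_gen g) \<longrightarrow>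
    (\<forall>r\<in>uq_rels q. h r = \<zero>\<^bsub>TT\<^esub>)"
  proof (rule ballI, rule impI)
    fix h assume h: "h \<in> alg_hom free_alg TT" "\<forall>g. h (Poly_Mapping.single [g] 1) = comult_gen g"
    show "\<forall>r\<in>uq_rels q. h r = \<zero>\<^bsub>TT\<^esub>"
      unfolding uq_rels_iff[OF PP.TT.calg_axioms h(1) h(2)[rule_format]]
      by (intro conjI comult_gen_relation)
        (simp_all add: s uq_relations PP.TT.smult_add PP.TT.smult_smult q)
  qed
  show "Uq_comult q \<in> alg_hom P TT" "Uq_comult q (gen (uq_rels q) g) = comult_gen g"
    unfolding eq using hom_on_gens[OF PP.TT.calg_axioms comult_gen_closed rel] by blast+
qed

end

section \<open>Relations and twisted Leibniz rules for a symmetry\<close>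

lemma Uq_sel:
  "carrier (Uq q) = carrier (presented_alg (uq_rels q))"
  "monoid.mult (Uq q) = monoid.mult (presented_alg (uq_rels q))"
  "one (Uq q) = one (presented_alg (uq_rels q))"
  "add (Uq q) = add (presented_alg (uq_rels q))"
  "module.smult (Uq q) = module.smult (presented_alg (uq_rels q))"
  "comult (Uq q) = Uq_comult q"
  by (simp_all add: Uq_def Uq_alg_def module.extend_def hopf_algebra.fields_def)

lemma End_alg_sel:
  "T \<in> carrier (End_alg A) \<longleftrightarrow> T \<in> carrier A \<rightarrow>\<^sub>E carrier A \<and>
       (\<forall>x\<in>carrier A. \<forall>y\<in>carrier A. T (x \<oplus>\<^bsub>A\<^esub> y) = T x \<oplus>\<^bsub>A\<^esub> T y) \<and>
       (\<forall>c. \<forall>x\<in>carrier A. T (c \<odot>\<^bsub>A\<^esub> x) = c \<odot>\<^bsub>A\<^esub> T x)"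
  "monoid.mult (End_alg A) = compose (carrier A)"
  "one (End_alg A) = (\<lambda>x\<in>carrier A. x)"
  "add (End_alg A) = (\<lambda>S T. \<lambda>x\<in>carrier A. S x \<oplus>\<^bsub>A\<^esub> T x)"
  "module.smult (End_alg A) = (\<lambda>c T. \<lambda>x\<in>carrier A. c \<odot>\<^bsub>A\<^esub> T x)"
  by (simp_all add: End_alg_def)

locale uq_symmetry = uq q + A: calg A
  for q :: complex and A :: "(complex, 'a, 'm) module_scheme" +
  fixes \<pi> :: "(uq_gen list \<Rightarrow>\<^sub>0 complex) set \<Rightarrow> 'a \<Rightarrow> 'a"
  assumes sym: "symmetry (Uq q) A \<pi>"
begin

lemma pi_hom: "\<pi> \<in> alg_hom (Uq q) (End_alg A)"
  using sym by (simp add: symmetry_def)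

lemmas pi_homD = alg_homD[OF pi_hom, unfolded Uq_sel End_alg_sel]

lemma pi_closed [simp]: "u \<in> carrier P \<Longrightarrow> a \<in> carrier A \<Longrightarrow> \<pi> u a \<in> carrier A"
  and pi_add: "u \<in> carrier P \<Longrightarrow> a \<in> carrier A \<Longrightarrow> b \<in> carrier A \<Longrightarrow> \<pi> u (a \<oplus>\<^bsub>A\<^esub> b) = \<pi> u a \<oplus>\<^bsub>A\<^esub> \<pi> u b"
  and pi_smult: "u \<in> carrier P \<Longrightarrow> a \<in> carrier A \<Longrightarrow> \<pi> u (c \<odot>\<^bsub>A\<^esub> a) = c \<odot>\<^bsub>A\<^esub> \<pi> u a"
  using pi_homD(1)[of u] by (auto simp: PiE_def Pi_def)

lemma pi_mult: "u \<in> carrier P \<Longrightarrow> v \<in> carrier P \<Longrightarrow> a \<in> carrier A \<Longrightarrow> \<pi> (u \<otimes>\<^bsub>P\<^esub> v) a = \<pi> u (\<pi> v a)"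
  by (simp add: pi_homD(3) compose_def)

lemma pi_smult': "u \<in> carrier P \<Longrightarrow> a \<in> carrier A \<Longrightarrow> \<pi> (c \<odot>\<^bsub>P\<^esub> u) a = c \<odot>\<^bsub>A\<^esub> \<pi> u a"
  using pi_homD(5)[of u c] by simp

lemma pi_add': "u \<in> carrier P \<Longrightarrow> v \<in> carrier P \<Longrightarrow> a \<in> carrier A \<Longrightarrow> \<pi> (u \<oplus>\<^bsub>P\<^esub> v) a = \<pi> u a \<oplus>\<^bsub>A\<^esub> \<pi> v a"
  by (simp add: pi_homD(2))

lemma pi_one: "a \<in> carrier A \<Longrightarrow> \<pi> \<one>\<^bsub>P\<^esub> a = a"
  using pi_homD(4) by simp

lemma pi_minus':
  "u \<in> carrier P \<Longrightarrow> v \<in> carrier P \<Longrightarrow> a \<in> carrier A \<Longrightarrow> \<pi> (u \<ominus>\<^bsub>P\<^esub> v) a = \<pi> u a \<ominus>\<^bsub>A\<^esub> \<pi> v a"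
  by (simp add: a_minus_def P.a_inv_smult A.a_inv_smult pi_add' pi_smult')

lemma pi_relations:
  assumes "a \<in> carrier A"
  shows "\<pi> Ki (\<pi> K a) = a" "\<pi> K (\<pi> Ki a) = a" "\<pi> K (\<pi> E a) = q\<^sup>2 \<odot>\<^bsub>A\<^esub> \<pi> E (\<pi> K a)"
    "\<pi> K (\<pi> F a) = (1 / q\<^sup>2) \<odot>\<^bsub>A\<^esub> \<pi> F (\<pi> K a)"
    "\<pi> E (\<pi> F a) \<ominus>\<^bsub>A\<^esub> \<pi> F (\<pi> E a) = \<kappa> \<odot>\<^bsub>A\<^esub> \<pi> K a \<ominus>\<^bsub>A\<^esub> \<kappa> \<odot>\<^bsub>A\<^esub> \<pi> Ki a"
proof -
  show "\<pi> Ki (\<pi> K a) = a" "\<pi> K (\<pi> Ki a) = a"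
    using assms by (simp_all add: pi_mult[symmetric] uq_relations pi_one)
  show "\<pi> K (\<pi> E a) = q\<^sup>2 \<odot>\<^bsub>A\<^esub> \<pi> E (\<pi> K a)" "\<pi> K (\<pi> F a) = (1 / q\<^sup>2) \<odot>\<^bsub>A\<^esub> \<pi> F (\<pi> K a)"
    using assms by (simp_all add: pi_mult[symmetric] uq_relations pi_smult')
  show "\<pi> E (\<pi> F a) \<ominus>\<^bsub>A\<^esub> \<pi> F (\<pi> E a) = \<kappa> \<odot>\<^bsub>A\<^esub> \<pi> K a \<ominus>\<^bsub>A\<^esub> \<kappa> \<odot>\<^bsub>A\<^esub> \<pi> Ki a"
    using assms by (simp only: pi_mult[symmetric] pi_minus'[symmetric] pi_smult'[symmetric]
        uq_relations gen_closed P.m_closed P.smult_closed)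
qed

text \<open>The axiom holds for every formal sum in the coset of the coproduct, so a short
  representative may be chosen.\<close>

lemma pi_product:
  assumes "a \<in> carrier A" "b \<in> carrier A" "u \<in> carrier P"
    "Poly_Mapping.keys s \<subseteq> carrier P \<times> carrier P" "Uq_comult q u = PP.IT +>\<^bsub>PP.FT\<^esub> s"
  shows "\<pi> u (a \<otimes>\<^bsub>A\<^esub> b) = lin_ext A (\<lambda>p. \<pi> (fst p) a \<otimes>\<^bsub>A\<^esub> \<pi> (snd p) b) s"
proof -
  have "s \<in> Uq_comult q u"
    using PP.IT.a_rcos_self[of s] assms(4,5) by simp
  then show ?thesis
    using sym assms(1-3) unfolding symmetry_def lin_ext_def Uq_sel by blast
qed

lemma pi_K_mult:
  assumes "a \<in> carrier A" "b \<in> carrier A"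
  shows "\<pi> K (a \<otimes>\<^bsub>A\<^esub> b) = \<pi> K a \<otimes>\<^bsub>A\<^esub> \<pi> K b"
  using assms
  by (subst pi_product[of _ _ _ "Poly_Mapping.single (K, K) 1"])
    (simp_all add: Uq_comult tensor_elt_def A.one_smult)

lemma pi_two_terms:
  assumes "a \<in> carrier A" "b \<in> carrier A" "u \<in> carrier P"
    and cl: "x \<in> carrier P" "y \<in> carrier P" "x' \<in> carrier P" "y' \<in> carrier P"
    and "Uq_comult q u = tt x y \<oplus>\<^bsub>TT\<^esub> tt x' y'"
  shows "\<pi> u (a \<otimes>\<^bsub>A\<^esub> b) = \<pi> x a \<otimes>\<^bsub>A\<^esub> \<pi> y b \<oplus>\<^bsub>A\<^esub> \<pi> x' a \<otimes>\<^bsub>A\<^esub> \<pi> y' b"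
proof -
  let ?s = "Poly_Mapping.single (x, y) (1::complex)" and ?s' = "Poly_Mapping.single (x', y') (1::complex)"
  let ?\<psi> = "\<lambda>p. \<pi> (fst p) a \<otimes>\<^bsub>A\<^esub> \<pi> (snd p) b"
  have "Uq_comult q u = PP.IT +>\<^bsub>PP.FT\<^esub> (?s + ?s')"
    unfolding assms(8) tensor_elt_def tensor_alg_def using cl
    by (subst PP.IT.quot_add) simp_all
  moreover have "Poly_Mapping.keys (?s + ?s') \<subseteq> carrier P \<times> carrier P"
    using cl keys_add[of ?s ?s'] by auto
  ultimately have "\<pi> u (a \<otimes>\<^bsub>A\<^esub> b) = lin_ext A ?\<psi> (?s + ?s')"
    using assms by (intro pi_product) auto
  also have "\<dots> = lin_ext A ?\<psi> ?s \<oplus>\<^bsub>A\<^esub> lin_ext A ?\<psi> ?s'"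
    using assms by (intro A.lin_ext_add[of _ "carrier P \<times> carrier P"]) auto
  finally show ?thesis using assms by (simp add: A.one_smult)
qed

lemma pi_E_mult:
  assumes "a \<in> carrier A" "b \<in> carrier A"
  shows "\<pi> E (a \<otimes>\<^bsub>A\<^esub> b) = a \<otimes>\<^bsub>A\<^esub> \<pi> E b \<oplus>\<^bsub>A\<^esub> \<pi> E a \<otimes>\<^bsub>A\<^esub> \<pi> K b"
  using assms by (subst pi_two_terms[of _ _ _ "\<one>\<^bsub>P\<^esub>" E E K]) (simp_all add: Uq_comult pi_one)

lemma pi_F_mult:
  assumes "a \<in> carrier A" "b \<in> carrier A"
  shows "\<pi> F (a \<otimes>\<^bsub>A\<^esub> b) = \<pi> F a \<otimes>\<^bsub>A\<^esub> b \<oplus>\<^bsub>A\<^esub> \<pi> Ki a \<otimes>\<^bsub>A\<^esub> \<pi> F b"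
  using assms by (subst pi_two_terms[of _ _ _ F "\<one>\<^bsub>P\<^esub>" Ki F]) (simp_all add: Uq_comult pi_one)

end

section \<open>Linear spans in an algebra\<close>

context calg
begin

lemma lin_span_induct:
  assumes "a \<in> lin_span A S" "S \<subseteq> N" "N \<subseteq> carrier A" "\<zero> \<in> N"
    "\<And>x y. x \<in> N \<Longrightarrow> y \<in> N \<Longrightarrow> x \<oplus> y \<in> N" "\<And>c x. x \<in> N \<Longrightarrow> c \<odot> x \<in> N"
  shows "a \<in> N"
proof -
  have "\<ominus> x \<in> N" if "x \<in> N" for x
    using that assms(3,6) a_inv_smult[of x] by auto
  then have "submodule N complex_alg A"
    using assms(3-6) by unfold_locales (auto simp flip: a_inv_def)
  then show ?thesis using assms(1,2) unfolding lin_span_def by blast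
qed

lemma lin_span_closed:
  assumes "S \<subseteq> carrier A" "a \<in> lin_span A S"
  shows "a \<in> carrier A"
  using assms(2) by (rule lin_span_induct) (use assms(1) in auto)

lemma lin_span_base: "a \<in> S \<Longrightarrow> a \<in> lin_span A S"
  by (auto simp: lin_span_def)

lemma lin_span_add:
  assumes "a \<in> lin_span A S" "b \<in> lin_span A S"
  shows "a \<oplus> b \<in> lin_span A S"
proof (unfold lin_span_def, intro InterI, clarify)
  fix N assume "submodule N complex_alg A" "S \<subseteq> N"
  then interpret submodule N complex_alg A by simp
  show "a \<oplus> b \<in> N"
    using m_closed[of a b] assms \<open>submodule N complex_alg A\<close> \<open>S \<subseteq> N\<close> by (auto simp: lin_span_def)
qed

lemma lin_span_smult:
  assumes "a \<in> lin_span A S"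
  shows "c \<odot> a \<in> lin_span A S"
proof (unfold lin_span_def, intro InterI, clarify)
  fix N assume "submodule N complex_alg A" "S \<subseteq> N"
  then interpret submodule N complex_alg A by simp
  show "c \<odot> a \<in> N"
    using smult_closed[of c a] assms \<open>submodule N complex_alg A\<close> \<open>S \<subseteq> N\<close>
    by (auto simp: lin_span_def complex_alg_def)
qed

end


section \<open>The quantum disc as an algebra of weighted shifts\<close>

definition linear_op :: "((int \<Rightarrow> complex) \<Rightarrow> int \<Rightarrow> complex) \<Rightarrow> bool" where
  "linear_op T \<longleftrightarrow> (\<forall>\<phi> \<psi>. T (\<lambda>i. \<phi> i + \<psi> i) = (\<lambda>i. T \<phi> i + T \<psi> i)) \<and>
     (\<forall>c \<phi>. T (\<lambda>i. c * \<phi> i) = (\<lambda>i. c * T \<phi> i))"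

lemma linear_opD:
  assumes "linear_op T"
  shows "T (\<lambda>l. \<phi> l + \<psi> l) i = T \<phi> i + T \<psi> i" "T (\<lambda>l. c * \<phi> l) i = c * T \<phi> i"
    "T (\<lambda>l. \<phi> l - \<psi> l) i = T \<phi> i - T \<psi> i"
proof -
  show *: "T (\<lambda>l. \<phi> l + \<psi> l) i = T \<phi> i + T \<psi> i" "T (\<lambda>l. c * \<phi> l) i = c * T \<phi> i" for \<phi> \<psi> c
    using assms unfolding linear_op_def by (simp_all add: fun_eq_iff)
  show "T (\<lambda>l. \<phi> l - \<psi> l) i = T \<phi> i - T \<psi> i"
    using *(1)[of \<phi> "\<lambda>l. (- 1) * \<psi> l"] *(2)[of "- 1" \<psi>] by simp
qed

definition op_alg :: "(complex, (int \<Rightarrow> complex) \<Rightarrow> int \<Rightarrow> complex) module" where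
  "op_alg = \<lparr>carrier = Collect linear_op, monoid.mult = (\<circ>), one = id, zero = (\<lambda>_ _. 0),
     add = (\<lambda>S T \<phi> i. S \<phi> i + T \<phi> i), module.smult = (\<lambda>c T \<phi> i. c * T \<phi> i)\<rparr>"

lemma op_alg_sel [simp]:
  "T \<in> carrier op_alg \<longleftrightarrow> linear_op T" "S \<otimes>\<^bsub>op_alg\<^esub> T = S \<circ> T" "\<one>\<^bsub>op_alg\<^esub> = id"
  "\<zero>\<^bsub>op_alg\<^esub> = (\<lambda>_ _. 0)" "S \<oplus>\<^bsub>op_alg\<^esub> T = (\<lambda>\<phi> i. S \<phi> i + T \<phi> i)"
  "c \<odot>\<^bsub>op_alg\<^esub> T = (\<lambda>\<phi> i. c * T \<phi> i)"
  by (simp_all add: op_alg_def)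

lemma calg_op_alg: "calg op_alg"
proof -
  have *: "\<exists>T'. linear_op T' \<and> (\<lambda>\<phi> i. T' \<phi> i + T \<phi> i) = (\<lambda>_ _. 0)" if "linear_op T" for T
    using that by (intro exI[of _ "\<lambda>\<phi> i. - T \<phi> i"]) (auto simp: linear_op_def)
  interpret ring op_alg
  proof (rule ringI)
    show "abelian_group op_alg"
    proof (rule abelian_groupI)
      fix T assume "T \<in> carrier op_alg"
      then show "\<exists>T'\<in>carrier op_alg. T' \<oplus>\<^bsub>op_alg\<^esub> T = \<zero>\<^bsub>op_alg\<^esub>"
        using * by (simp add: Bex_def)
    qed (auto simp: linear_op_def fun_eq_iff algebra_simps)
    show "Group.monoid op_alg"
      by (rule monoidI) (simp_all add: linear_op_def o_assoc)
  qed (auto simp: linear_op_def fun_eq_iff)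
  show ?thesis
    by unfold_locales (auto simp: linear_op_def fun_eq_iff algebra_simps)
qed

locale disc = presented "disc_rels q" for q :: complex +
  assumes q: "q \<noteq> 0" and not_root: "\<And>m::nat. m > 0 \<Longrightarrow> q ^ m \<noteq> 1"
begin

abbreviation "z \<equiv> gen (disc_rels q) Z"
abbreviation "w \<equiv> gen (disc_rels q) Zstar"

lemma powi_eq_1_iff: "q powi n = 1 \<longleftrightarrow> n = 0"
  using not_root[of "nat n"] not_root[of "nat (- n)"] q
  by (cases n "0::int" rule: linorder_cases) (auto simp: power_int_def power_inverse)

definition X :: "int \<Rightarrow> complex" where "X l = q powi (2 * l)"

lemma X_add: "X (l + m) = X l * X m"
  using q by (simp add: X_def power_int_add distrib_left)

lemma X_0 [simp]: "X 0 = 1" and X_1: "X 1 = q\<^sup>2" and X_nz [simp]: "X l \<noteq> 0"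
  using q by (simp_all add: X_def)

lemma X_minus: "X (- l) = 1 / X l"
  using X_add[of l "- l"] by (simp add: field_simps)

lemma X_Suc: "X l = q\<^sup>2 * X (l - 1)"
  using X_add[of "l - 1" 1] by (simp add: X_1 mult.commute)

lemma X_eq_1_iff [simp]: "X l = 1 \<longleftrightarrow> l = 0"
  by (simp add: X_def powi_eq_1_iff)

lemma inj_X: "inj X"
proof (rule injI)
  fix l m assume "X l = X m"
  then have "X (l - m) = 1" using X_add[of "l - m" m] by simp
  then show "l = m" by simp
qed

lemma disc_relation:
  "z \<otimes>\<^bsub>P\<^esub> w = q\<^sup>2 \<odot>\<^bsub>P\<^esub> (w \<otimes>\<^bsub>P\<^esub> z) \<oplus>\<^bsub>P\<^esub> (1 - q\<^sup>2) \<odot>\<^bsub>P\<^esub> \<one>\<^bsub>P\<^esub>"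
proof -
  have "Poly_Mapping.single [Z, Zstar] 1
      - (Poly_Mapping.single [Zstar, Z] (q\<^sup>2) + Poly_Mapping.single [] (1 - q\<^sup>2)) \<in> disc_rels q"
    by (simp add: disc_rels_def)
  from cls_rel[OF this] show ?thesis
    by (simp add: cls_lin cls_single P.one_smult P.minus_eq_zero_iff)
qed

text \<open>
  With \<open>y = 1 - z z\<^sup>*\<close> acting as multiplication by \<open>X\<close>, this is the skew Laurent realisation
  \<open>z y = q\<^sup>2 y z\<close>, \<open>z\<^sup>* = z\<^sup>-\<^sup>1 (1 - y)\<close>.
\<close>

definition shift_gen :: "disc_gen \<Rightarrow> (int \<Rightarrow> complex) \<Rightarrow> int \<Rightarrow> complex" where
  "shift_gen g = (case g of Z \<Rightarrow> (\<lambda>\<phi> l. \<phi> (l + 1)) | Zstar \<Rightarrow> (\<lambda>\<phi> l. (1 - X (l - 1)) * \<phi> (l - 1)))"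

definition \<rho> where "\<rho> = hom_on_gens (disc_rels q) op_alg shift_gen"

lemma \<rho>_hom: "\<rho> \<in> alg_hom P op_alg" and \<rho>_gen: "\<rho> (gen (disc_rels q) g) = shift_gen g"
proof -
  interpret O: calg op_alg by (rule calg_op_alg)
  have c: "shift_gen g \<in> carrier op_alg" for g
    by (cases g) (auto simp: shift_gen_def linear_op_def fun_eq_iff algebra_simps)
  have eq: "shift_gen Z \<circ> shift_gen Zstar
      = (\<lambda>\<phi> i. q\<^sup>2 * shift_gen Zstar (shift_gen Z \<phi>) i + (1 - q\<^sup>2) * \<phi> i)"
  proof (intro ext)
    fix \<phi> l
    have "X l = X (l - 1) * q\<^sup>2" using X_add[of "l - 1" 1] by (simp add: X_1)
    then show "(shift_gen Z \<circ> shift_gen Zstar) \<phi> l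
        = q\<^sup>2 * shift_gen Zstar (shift_gen Z \<phi>) l + (1 - q\<^sup>2) * \<phi> l"
      by (simp add: shift_gen_def algebra_simps)
  qed
  have "\<forall>h\<in>alg_hom free_alg op_alg. (\<forall>g. h (Poly_Mapping.single [g] 1) = shift_gen g) \<longrightarrow>
    (\<forall>r\<in>disc_rels q. h r = \<zero>\<^bsub>op_alg\<^esub>)"
  proof (intro ballI impI)
    fix h r assume h: "h \<in> alg_hom free_alg op_alg" "\<forall>g. h (Poly_Mapping.single [g] 1) = shift_gen g"
      and r: "r \<in> disc_rels q"
    let ?a = "shift_gen Z \<otimes>\<^bsub>op_alg\<^esub> shift_gen Zstar"
      and ?b = "q\<^sup>2 \<odot>\<^bsub>op_alg\<^esub> (shift_gen Zstar \<otimes>\<^bsub>op_alg\<^esub> shift_gen Z) \<oplus>\<^bsub>op_alg\<^esub> (1 - q\<^sup>2) \<odot>\<^bsub>op_alg\<^esub> \<one>\<^bsub>op_alg\<^esub>"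
    have ab: "?a = ?b" "?a \<in> carrier op_alg"
      using eq O.m_closed[OF c c] by (simp_all add: fun_eq_iff)
    have "h r = ?a \<ominus>\<^bsub>op_alg\<^esub> ?b"
      using r c O.m_closed unfolding disc_rels_def
      by (simp add: alg_hom_free_lin[OF calg_op_alg h(1)] alg_hom_free_single[OF calg_op_alg h(1) h(2)[rule_format]]
          O.one_smult del: op_alg_sel)
    then show "h r = \<zero>\<^bsub>op_alg\<^esub>" using ab O.r_neg by (simp add: a_minus_def del: op_alg_sel)
  qed
  from hom_on_gens[OF calg_op_alg c this]
  show "\<rho> \<in> alg_hom P op_alg" "\<rho> (gen (disc_rels q) g) = shift_gen g"
    unfolding \<rho>_def by blast+
qed

lemma \<rho>_z: "\<rho> z \<phi> l = \<phi> (l + 1)" and \<rho>_w: "\<rho> w \<phi> l = (1 - X (l - 1)) * \<phi> (l - 1)"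
  by (simp_all add: \<rho>_gen shift_gen_def)

lemma \<rho>_one: "\<rho> \<one>\<^bsub>P\<^esub> = id"
  and \<rho>_mult: "a \<in> carrier P \<Longrightarrow> b \<in> carrier P \<Longrightarrow> \<rho> (a \<otimes>\<^bsub>P\<^esub> b) = \<rho> a \<circ> \<rho> b"
  and \<rho>_add: "a \<in> carrier P \<Longrightarrow> b \<in> carrier P \<Longrightarrow> \<rho> (a \<oplus>\<^bsub>P\<^esub> b) \<phi> l = \<rho> a \<phi> l + \<rho> b \<phi> l"
  and \<rho>_smult: "a \<in> carrier P \<Longrightarrow> \<rho> (c \<odot>\<^bsub>P\<^esub> a) \<phi> l = c * \<rho> a \<phi> l"
  and \<rho>_linear: "a \<in> carrier P \<Longrightarrow> linear_op (\<rho> a)"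
  using alg_homD[OF \<rho>_hom] by auto

lemma \<rho>_add_fun: "a \<in> carrier P \<Longrightarrow> b \<in> carrier P \<Longrightarrow> \<rho> (a \<oplus>\<^bsub>P\<^esub> b) \<phi> = (\<lambda>l. \<rho> a \<phi> l + \<rho> b \<phi> l)"
  and \<rho>_smult_fun: "a \<in> carrier P \<Longrightarrow> \<rho> (c \<odot>\<^bsub>P\<^esub> a) \<phi> = (\<lambda>l. c * \<rho> a \<phi> l)"
  by (simp_all add: fun_eq_iff \<rho>_add \<rho>_smult)

lemma \<rho>_zero: "\<rho> \<zero>\<^bsub>P\<^esub> \<phi> l = 0"
  using \<rho>_smult[of "\<one>\<^bsub>P\<^esub>" 0 \<phi> l] by (simp add: P.zero_smult)

lemma \<rho>_minus: "a \<in> carrier P \<Longrightarrow> b \<in> carrier P \<Longrightarrow> \<rho> (a \<ominus>\<^bsub>P\<^esub> b) \<phi> l = \<rho> a \<phi> l - \<rho> b \<phi> l"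
  by (simp add: a_minus_def P.a_inv_smult \<rho>_add \<rho>_smult)

lemma \<rho>_finsum:
  assumes "finite S" "\<And>i. i \<in> S \<Longrightarrow> f i \<in> carrier P"
  shows "\<rho> (\<Oplus>\<^bsub>P\<^esub>i\<in>S. f i) \<phi> l = (\<Sum>i\<in>S. \<rho> (f i) \<phi> l)"
  using assms by (induction S) (auto simp: \<rho>_zero \<rho>_add P.finsum_insert)

section \<open>Homogeneous elements and their weights\<close>

definition homog :: "int \<Rightarrow> (int \<Rightarrow> complex) \<Rightarrow> (disc_gen list \<Rightarrow>\<^sub>0 complex) set \<Rightarrow> bool" where
  "homog k u a \<longleftrightarrow> a \<in> carrier P \<and> (\<forall>\<phi> l. \<rho> a \<phi> l = u l * \<phi> (l + k))"

lemma homog_closed: "homog k u a \<Longrightarrow> a \<in> carrier P"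
  by (simp add: homog_def)

lemma homog_z: "homog 1 (\<lambda>_. 1) z" and homog_w: "homog (- 1) (\<lambda>l. 1 - X (l - 1)) w"
  and homog_one: "homog 0 (\<lambda>_. 1) \<one>\<^bsub>P\<^esub>"
  by (simp_all add: homog_def \<rho>_z \<rho>_w \<rho>_one)

lemma homog_mult:
  assumes "homog k u a" "homog m v b"
  shows "homog (k + m) (\<lambda>l. u l * v (l + k)) (a \<otimes>\<^bsub>P\<^esub> b)"
  using assms by (auto simp: homog_def \<rho>_mult add.assoc)

lemma homog_add:
  assumes "homog k u a" "homog k v b"
  shows "homog k (\<lambda>l. u l + v l) (a \<oplus>\<^bsub>P\<^esub> b)"
  using assms by (auto simp: homog_def \<rho>_add algebra_simps)

lemma homog_minus:
  assumes "homog k u a" "homog k v b"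
  shows "homog k (\<lambda>l. u l - v l) (a \<ominus>\<^bsub>P\<^esub> b)"
  using assms by (auto simp: homog_def \<rho>_minus algebra_simps)

lemma homog_smult:
  assumes "homog k u a"
  shows "homog k (\<lambda>l. c * u l) (c \<odot>\<^bsub>P\<^esub> a)"
  using assms by (auto simp: homog_def \<rho>_smult)

text \<open>The weight of the power \<open>j\<close> of \<open>w\<close>, see
  \<open>homog_w_pow\<close>. It vanishes exactly for 1 \<le> l \<le> j.\<close>

definition W :: "nat \<Rightarrow> int \<Rightarrow> complex" where
  "W j l = (\<Prod>t<j. 1 - X (l - 1 - int t))"

text \<open>The forced factor of weights in degree \<open>k\<close>: for negative \<open>k\<close>
  every such weight is a polynomial multiple of the weight of the power \<open>- k\<close> of
  \<open>w\<close>; for the other degrees there is no constraint.\<close>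

definition N :: "int \<Rightarrow> int \<Rightarrow> complex" where
  "N k l = W (nat (- k)) l"

lemma N_nonneg [simp]: "k \<ge> 0 \<Longrightarrow> N k l = 1"
  by (simp add: N_def W_def)

lemma W_nz: "l \<le> 0 \<Longrightarrow> W j l \<noteq> 0"
  by (auto simp: W_def)

lemma N_nz: "l \<le> 0 \<Longrightarrow> N k l \<noteq> 0"
  by (simp add: N_def W_nz)

lemma W_Suc: "W (Suc j) l = W j l * (1 - X (l - 1 - int j))"
  by (simp add: W_def)

lemma W_add: "W (i + j) l = W i l * W j (l - int i)"
  by (induction j) (simp_all add: W_Suc algebra_simps, simp add: W_def)

lemma W_poly: "\<exists>p. \<forall>l. W j (l + m) = poly p (X l)"
proof (induction j)
  case 0
  show ?case by (intro exI[of _ 1]) (simp add: W_def)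
next
  case (Suc j)
  then obtain p where p: "W j (l + m) = poly p (X l)" for l by blast
  have "W (Suc j) (l + m) = poly (p * [:1, - X (m - 1 - int j):]) (X l)" for l
    using X_add[of l "m - 1 - int j"] by (simp add: W_Suc p algebra_simps)
  then show ?case by blast
qed

definition zw :: "nat \<times> nat \<Rightarrow> (disc_gen list \<Rightarrow>\<^sub>0 complex) set" where
  "zw p = z [^]\<^bsub>P\<^esub> fst p \<otimes>\<^bsub>P\<^esub> w [^]\<^bsub>P\<^esub> snd p"

lemma zw_closed [simp]: "zw p \<in> carrier P"
  by (simp add: zw_def)

lemma z_zw: "z \<otimes>\<^bsub>P\<^esub> zw (i, j) = zw (Suc i, j)"
  unfolding zw_def fst_conv snd_conv P.nat_pow_Suc2[OF gen_closed] by (simp add: P.m_assoc)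

lemma homog_z_pow: "homog (int i) (\<lambda>_. 1) (z [^]\<^bsub>P\<^esub> i)"
proof (induction i)
  case (Suc i)
  from homog_mult[OF this homog_z] show ?case by (simp add: add.commute)
qed (simp add: homog_one)

lemma homog_w_pow: "homog (- int j) (W j) (w [^]\<^bsub>P\<^esub> j)"
proof (induction j)
  case (Suc j)
  from homog_mult[OF this homog_w] show ?case
    by (simp add: W_Suc[abs_def] algebra_simps)
qed (simp add: homog_one W_def[abs_def])

lemma homog_zw: "homog (int i - int j) (\<lambda>l. W j (l + int i)) (zw (i, j))"
  using homog_mult[OF homog_z_pow homog_w_pow, of i j] by (simp add: zw_def)

text \<open>For j > i the product is cut after i factors. The shift by i makes the remaining j - i
  factors start at l, where they form \<open>N (int i - int j) l\<close>, and the first i factors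
  are a polynomial in \<open>X l\<close>.\<close>

lemma zw_weight: "\<exists>p. \<forall>l. W j (l + int i) = poly p (X l) * N (int i - int j) l"
proof (cases "j \<le> i")
  case True
  then show ?thesis using W_poly[of j "int i"] by simp
next
  case False
  then have "W j (l + int i) = W i (l + int i) * N (int i - int j) l" for l
  proof -
    have "nat (- (int i - int j)) = j - i" by linarith
    then show ?thesis using False W_add[of i "j - i" "l + int i"] by (simp add: N_def)
  qed
  then show ?thesis using W_poly[of i "int i"] by auto
qed

definition polyhom :: "int \<Rightarrow> complex poly \<Rightarrow> (disc_gen list \<Rightarrow>\<^sub>0 complex) set \<Rightarrow> bool" where
  "polyhom k p a \<longleftrightarrow> homog k (\<lambda>l. poly p (X l) * N k l) a"

lemma polyhom_zw: "\<exists>p. polyhom (int i - int j) p (zw (i, j))"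
  using zw_weight[of j i] homog_zw[of i j] by (auto simp: polyhom_def)

lemma disc_grade_eq: "disc_grade q k = lin_span P {zw (i, j) | i j. int i - int j = k}"
  by (simp add: disc_grade_def Pol_disc_def zw_def)

lemma zw_in_grade: "zw (i, j) \<in> disc_grade q (int i - int j)"
  unfolding disc_grade_eq by (rule P.lin_span_base) blast

lemma grade_closed: "a \<in> disc_grade q k \<Longrightarrow> a \<in> carrier P"
  unfolding disc_grade_eq by (erule P.lin_span_closed[rotated]) auto

lemma grade_polyhom:
  assumes "a \<in> disc_grade q k"
  shows "\<exists>p. polyhom k p a"
proof -
  have "a \<in> {a. \<exists>p. polyhom k p a}"
    using assms unfolding disc_grade_eq
  proof (rule P.lin_span_induct)
    show "{zw (i, j) |i j. int i - int j = k} \<subseteq> {a. \<exists>p. polyhom k p a}"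
      using polyhom_zw by blast
    show "{a. \<exists>p. polyhom k p a} \<subseteq> carrier P"
      by (auto simp: polyhom_def homog_def)
    show "\<zero>\<^bsub>P\<^esub> \<in> {a. \<exists>p. polyhom k p a}"
      by (auto simp: polyhom_def homog_def \<rho>_zero intro: exI[of _ 0])
  next
    fix a b assume "a \<in> {a. \<exists>p. polyhom k p a}" "b \<in> {a. \<exists>p. polyhom k p a}"
    then obtain p p' where "polyhom k p a" "polyhom k p' b" by auto
    then have "polyhom k (p + p') (a \<oplus>\<^bsub>P\<^esub> b)"
      unfolding polyhom_def by (drule_tac homog_add) (simp_all add: algebra_simps)
    then show "a \<oplus>\<^bsub>P\<^esub> b \<in> {a. \<exists>p. polyhom k p a}" by blast
  next
    fix a c assume "a \<in> {a. \<exists>p. polyhom k p a}"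
    then obtain p where "polyhom k p a" by auto
    then have "polyhom k (Polynomial.smult c p) (c \<odot>\<^bsub>P\<^esub> a)"
      unfolding polyhom_def using homog_smult[of k _ a c] by (simp add: algebra_simps)
    then show "c \<odot>\<^bsub>P\<^esub> a \<in> {a. \<exists>p. polyhom k p a}" by blast
  qed
  then show ?thesis by simp
qed

section \<open>Normal ordering: the monomials span the algebra\<close>

lemma w_z_relation: "w \<otimes>\<^bsub>P\<^esub> z = (1 / q\<^sup>2) \<odot>\<^bsub>P\<^esub> (z \<otimes>\<^bsub>P\<^esub> w) \<oplus>\<^bsub>P\<^esub> (1 - 1 / q\<^sup>2) \<odot>\<^bsub>P\<^esub> \<one>\<^bsub>P\<^esub>"
proof -
  have "(1 / q\<^sup>2) \<odot>\<^bsub>P\<^esub> (z \<otimes>\<^bsub>P\<^esub> w) \<oplus>\<^bsub>P\<^esub> (1 - 1 / q\<^sup>2) \<odot>\<^bsub>P\<^esub> \<one>\<^bsub>P\<^esub> =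
    w \<otimes>\<^bsub>P\<^esub> z \<oplus>\<^bsub>P\<^esub> (((1 / q\<^sup>2) * (1 - q\<^sup>2)) \<odot>\<^bsub>P\<^esub> \<one>\<^bsub>P\<^esub> \<oplus>\<^bsub>P\<^esub> (1 - 1 / q\<^sup>2) \<odot>\<^bsub>P\<^esub> \<one>\<^bsub>P\<^esub>)"
    using q by (simp add: disc_relation P.smult_add P.smult_smult P.one_smult P.a_assoc)
  also have "\<dots> = w \<otimes>\<^bsub>P\<^esub> z \<oplus>\<^bsub>P\<^esub> 0 \<odot>\<^bsub>P\<^esub> \<one>\<^bsub>P\<^esub>"
    using q by (subst P.add_smult[symmetric]) (simp_all add: field_simps)
  finally show ?thesis by (simp add: P.zero_smult)
qed

abbreviation "mspan \<equiv> lin_span P (range zw)"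

lemma mspan_closed: "a \<in> mspan \<Longrightarrow> a \<in> carrier P"
  by (erule P.lin_span_closed[rotated]) auto

lemma w_zw_in_span: "w \<otimes>\<^bsub>P\<^esub> zw (i, j) \<in> mspan"
proof (induction i)
  case 0
  have "w \<otimes>\<^bsub>P\<^esub> zw (0, j) = zw (0, Suc j)"
    unfolding zw_def fst_conv snd_conv P.nat_pow_Suc2[OF gen_closed] by simp
  then show ?case using P.lin_span_base by simp
next
  case (Suc i)
  have zspan: "z \<otimes>\<^bsub>P\<^esub> a \<in> mspan \<and> a \<in> carrier P" if "a \<in> mspan" for a
  proof -
    have "a \<in> {a \<in> carrier P. z \<otimes>\<^bsub>P\<^esub> a \<in> mspan}"
      using that
    proof (rule P.lin_span_induct)
      show "range zw \<subseteq> {a \<in> carrier P. z \<otimes>\<^bsub>P\<^esub> a \<in> mspan}"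
        using P.lin_span_base z_zw by auto
      have "\<zero>\<^bsub>P\<^esub> \<in> mspan"
        using P.lin_span_smult[OF P.lin_span_base[of "zw (0,0)"], of "range zw" 0] by (simp add: P.zero_smult)
      then show "\<zero>\<^bsub>P\<^esub> \<in> {a \<in> carrier P. z \<otimes>\<^bsub>P\<^esub> a \<in> mspan}" by simp
    qed (auto simp: P.r_distr P.mult_smult intro: P.lin_span_add P.lin_span_smult)
    then show ?thesis by simp
  qed
  have "w \<otimes>\<^bsub>P\<^esub> zw (Suc i, j) = (w \<otimes>\<^bsub>P\<^esub> z) \<otimes>\<^bsub>P\<^esub> zw (i, j)"
    by (simp add: z_zw[symmetric] P.m_assoc)
  also have "\<dots> = (1 / q\<^sup>2) \<odot>\<^bsub>P\<^esub> (z \<otimes>\<^bsub>P\<^esub> (w \<otimes>\<^bsub>P\<^esub> zw (i, j))) \<oplus>\<^bsub>P\<^esub> (1 - 1 / q\<^sup>2) \<odot>\<^bsub>P\<^esub> zw (i, j)"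
    unfolding w_z_relation by (simp add: P.l_distr P.smult_mult P.m_assoc)
  also have "\<dots> \<in> mspan"
    using zspan[OF Suc] by (intro P.lin_span_add P.lin_span_smult) (auto intro: P.lin_span_base)
  finally show ?case .
qed

text \<open>The span is stable under left multiplication by both generators, hence by every element,
  and it contains 1 = \<open>zw (0, 0)\<close>.\<close>

lemma carrier_in_span:
  assumes "a \<in> carrier P"
  shows "a \<in> mspan"
proof -
  have "a \<otimes>\<^bsub>P\<^esub> b \<in> mspan" if "b \<in> mspan" for b
    using assms that
  proof (induction arbitrary: b rule: presented_induct)
    case (gen g)
    have "b \<in> {b \<in> carrier P. gen (disc_rels q) g \<otimes>\<^bsub>P\<^esub> b \<in> mspan}"
      using gen
    proof (rule P.lin_span_induct)
      show "range zw \<subseteq> {b \<in> carrier P. gen (disc_rels q) g \<otimes>\<^bsub>P\<^esub> b \<in> mspan}"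
        using P.lin_span_base w_zw_in_span z_zw by (cases g) auto
      have "\<zero>\<^bsub>P\<^esub> \<in> mspan"
        using P.lin_span_smult[OF P.lin_span_base[of "zw (0,0)"], of "range zw" 0] by (simp add: P.zero_smult)
      then show "\<zero>\<^bsub>P\<^esub> \<in> {b \<in> carrier P. gen (disc_rels q) g \<otimes>\<^bsub>P\<^esub> b \<in> mspan}" by simp
    qed (auto simp: P.r_distr P.mult_smult intro: P.lin_span_add P.lin_span_smult)
    then show ?case by simp
  next
    case one
    then show ?case using mspan_closed[of b] by auto
  next
    case (add x y)
    then show ?case
      using mspan_closed[of b] by (auto simp: P.l_distr intro: P.lin_span_add)
  next
    case (smult c x)
    then show ?case
      using mspan_closed[of b] by (auto simp: P.smult_mult intro: P.lin_span_smult)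
  next
    case (mult x y)
    then show ?case
      using mspan_closed[of b] by (auto simp: P.m_assoc)
  qed
  moreover have "zw (0, 0) \<in> mspan" by (rule P.lin_span_base) simp
  ultimately have "a \<otimes>\<^bsub>P\<^esub> zw (0, 0) \<in> mspan" .
  then show ?thesis using assms by (simp add: zw_def[of "(0, 0)"])
qed

lemma carrier_lin_ext:
  assumes "a \<in> carrier P"
  shows "\<exists>s. a = lin_ext P zw s"
proof -
  have c: "zw \<in> UNIV \<rightarrow> carrier P" by simp
  have "a \<in> range (lin_ext P zw)"
    using carrier_in_span[OF assms]
  proof (rule P.lin_span_induct)
    show "range zw \<subseteq> range (lin_ext P zw)"
    proof clarify
      fix i j
      have "zw (i, j) = lin_ext P zw (Poly_Mapping.single (i, j) 1)" by (simp add: P.one_smult)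
      then show "zw (i, j) \<in> range (lin_ext P zw)" by blast
    qed
    show "range (lin_ext P zw) \<subseteq> carrier P"
      using P.lin_ext_closed[OF c] by auto
    show "\<zero>\<^bsub>P\<^esub> \<in> range (lin_ext P zw)"
      by (rule range_eqI[of _ _ 0]) simp
  qed (auto simp: P.lin_ext_add[OF c, symmetric] P.lin_ext_map_times[OF c, symmetric])
  then show ?thesis by blast
qed

section \<open>Faithfulness of the shift representation and homogeneous components\<close>

lemma \<rho>_lin_ext:
  "\<rho> (lin_ext P zw s) \<phi> l =
    (\<Sum>p\<in>Poly_Mapping.keys s. Poly_Mapping.lookup s p * W (snd p) (l + int (fst p)) * \<phi> (l + (int (fst p) - int (snd p))))"
proof -
  have "\<rho> (zw p) \<phi> l = W (snd p) (l + int (fst p)) * \<phi> (l + (int (fst p) - int (snd p)))" for p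
    using homog_zw[of "fst p" "snd p"] by (simp add: homog_def)
  then show ?thesis
    by (simp add: lin_ext_def \<rho>_finsum \<rho>_smult mult.assoc)
qed

lemma \<rho>_eq_0_imp:
  assumes "a \<in> carrier P" "\<And>\<phi> l. \<rho> a \<phi> l = 0"
  shows "a = \<zero>\<^bsub>P\<^esub>"
proof -
  obtain s where s: "a = lin_ext P zw s" using carrier_lin_ext[OF assms(1)] by blast
  \<comment> \<open>The weights of the monomials of a fixed degree are triangular: at \<open>l = - i\<close>, that of
    \<open>z\<^sup>i (z\<^sup>*)\<^sup>j\<close> is nonzero and those with a higher power of \<open>z\<^sup>*\<close> vanish.\<close>
  have "Poly_Mapping.lookup s (i, j) = 0" for i j
  proof (induction j arbitrary: i rule: less_induct)
    case (less j)
    \<comment> \<open>The point mass at \<open>- j\<close>, read off at \<open>- i\<close>, sees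
      exactly the monomials of degree i - j. Among these, a smaller power of \<open>w\<close> has
      coefficient zero by the induction hypothesis.\<close>
    let ?\<phi> = "\<lambda>m. if m = - int j then 1 else 0 :: complex" and ?l = "- int i"
    have *: "Poly_Mapping.lookup s p * W (snd p) (?l + int (fst p)) * ?\<phi> (?l + (int (fst p) - int (snd p)))
        = (if p = (i, j) then Poly_Mapping.lookup s p * W j 0 else 0)" for p
    proof (cases "int (fst p) - int (snd p) = int i - int j")
      case True
      consider "snd p < j" | "snd p = j" | "snd p > j" by linarith
      then show ?thesis
      proof cases
        case 1
        then show ?thesis using less[of "snd p" "fst p"] by auto
      next
        case 2
        with True have "p = (i, j)" by (auto simp: prod_eq_iff)
        then show ?thesis by simp
      next
        case 3
        \<comment> \<open>Equal degrees give \<open>fst p - i = snd p - j\<close>, so the factor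
          with index \<open>snd p - j - 1\<close> is 1 - X 0.\<close>
        have "W (snd p) (?l + int (fst p)) = 0"
          unfolding W_def using 3 True
          by (intro prod_zero bexI[of _ "snd p - j - 1"]) (auto simp: of_nat_diff)
        then show ?thesis using 3 by auto
      qed
    qed auto
    have "0 = (\<Sum>p\<in>Poly_Mapping.keys s. if p = (i, j) then Poly_Mapping.lookup s p * W j 0 else 0)"
      using \<rho>_lin_ext[of s ?\<phi> ?l] assms(2)[of ?\<phi> ?l] s unfolding * by simp
    also have "\<dots> = Poly_Mapping.lookup s (i, j) * W j 0"
      by (simp add: in_keys_iff)
    finally show ?case using W_nz[of 0 j] by simp
  qed
  then have "s = 0" by (intro poly_mapping_eqI) auto
  then show ?thesis using s by simp
qed

lemma homog_eqI:
  assumes "homog k u a" "homog k v b" "\<And>l. u l = v l"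
  shows "a = b"
proof -
  have "a \<ominus>\<^bsub>P\<^esub> b = \<zero>\<^bsub>P\<^esub>"
    using assms by (intro \<rho>_eq_0_imp) (auto simp: homog_def \<rho>_minus)
  then show ?thesis
    using P.minus_eq_zero_iff[of a b] homog_closed[OF assms(1)] homog_closed[OF assms(2)] by simp
qed

text \<open>A half-line already supplies infinitely many roots. This form is used because identities
  between weights become polynomial ones only where \<open>N\<close> can be cancelled.\<close>

lemma poly_X_zero:
  assumes "\<And>l. l < L \<Longrightarrow> poly p (X l) = 0"
  shows "p = 0"
proof (rule ccontr)
  assume "p \<noteq> 0"
  then have "finite {x. poly p x = 0}" by (rule poly_roots_finite)
  moreover have "X ` {..<L} \<subseteq> {x. poly p x = 0}" using assms by auto
  ultimately have "finite (X ` {..<L})" by (rule finite_subset[rotated])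
  then have "finite {..<L}" using inj_X by (metis finite_imageD inj_on_subset subset_UNIV)
  then show False by (simp add: infinite_Iio)
qed

lemma poly_X_nonzero:
  assumes "p \<noteq> 0"
  shows "\<exists>L. \<forall>l<L. poly p (X l) \<noteq> 0"
proof -
  have "finite (X -` {x. poly p x = 0})"
    by (rule finite_vimageI[OF poly_roots_finite[OF assms] inj_X])
  then obtain L where "\<And>l. l \<in> X -` {x. poly p x = 0} \<Longrightarrow> L \<le> l"
    by (metis Min_le)
  then show ?thesis by (force intro: exI[of _ L])
qed

text \<open>Monomials are grouped by degree. This gives access to elements that are not yet known to
  be homogeneous, such as the image of a generator under k.\<close>

lemma \<rho>_expansion:
  assumes "a \<in> carrier P"
  shows "\<exists>S p. finite S \<and> (\<forall>\<phi> l. \<rho> a \<phi> l = (\<Sum>k\<in>S. poly (p k) (X l) * N k l * \<phi> (l + k)))"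
proof -
  obtain s where s: "a = lin_ext P zw s" using carrier_lin_ext[OF assms] by blast
  define d where "d p = int (fst p) - int (snd p)" for p :: "nat \<times> nat"
  obtain r where r: "W (snd p) (l + int (fst p)) = poly (r p) (X l) * N (d p) l" for p l
  proof -
    have "\<forall>p. \<exists>r. \<forall>l. W (snd p) (l + int (fst p)) = poly r (X l) * N (d p) l"
      unfolding d_def using zw_weight by blast
    then show ?thesis using that by metis
  qed
  let ?K = "Poly_Mapping.keys s"
  let ?p = "\<lambda>k. \<Sum>p\<in>{p \<in> ?K. d p = k}. Polynomial.smult (Poly_Mapping.lookup s p) (r p)"
  have "\<rho> a \<phi> l = (\<Sum>k\<in>d ` ?K. poly (?p k) (X l) * N k l * \<phi> (l + k))" for \<phi> l
  proof -
    have "\<rho> a \<phi> l = (\<Sum>p\<in>?K. Poly_Mapping.lookup s p * poly (r p) (X l) * N (d p) l * \<phi> (l + d p))"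
      by (simp add: s \<rho>_lin_ext r d_def[symmetric] mult.assoc)
    also have "\<dots> = (\<Sum>k\<in>d ` ?K. \<Sum>p\<in>{p \<in> ?K. d p = k}.
        Poly_Mapping.lookup s p * poly (r p) (X l) * N (d p) l * \<phi> (l + d p))"
      by (rule sum.image_gen) simp
    also have "\<dots> = (\<Sum>k\<in>d ` ?K. poly (?p k) (X l) * N k l * \<phi> (l + k))"
      by (intro sum.cong refl) (simp add: poly_sum sum_distrib_right)
    finally show ?thesis .
  qed
  then show ?thesis by (intro exI[of _ "d ` ?K"] exI[of _ ?p]) auto
qed

text \<open>Point masses isolate the component of \<open>c\<close> in one degree, and far to the
  left the weight of the nonzero element \<open>a\<close> does not vanish. Hence a component of
  \<open>c\<close> of degree other than D - d would show up in the product.\<close>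

lemma homog_factor:
  assumes c: "c \<in> carrier P" and a: "polyhom d p a" "a \<noteq> \<zero>\<^bsub>P\<^esub>"
    and ac: "homog D v (a \<otimes>\<^bsub>P\<^esub> c)"
  shows "\<exists>r. polyhom (D - d) r c"
proof -
  have ac': "a \<in> carrier P" using a by (simp add: polyhom_def homog_def)
  have "p \<noteq> 0"
    using a \<rho>_eq_0_imp[OF ac'] by (auto simp: polyhom_def homog_def)
  then obtain L where L: "\<And>l. l < L \<Longrightarrow> poly p (X l) \<noteq> 0" using poly_X_nonzero by blast
  obtain S r where S: "finite S"
    and r: "\<And>\<phi> l. \<rho> c \<phi> l = (\<Sum>k\<in>S. poly (r k) (X l) * N k l * \<phi> (l + k))"
    using \<rho>_expansion[OF c] by blast
  have 0: "r s = 0" if "s \<in> S" "s \<noteq> D - d" for s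
  proof (rule poly_X_zero)
    \<comment> \<open>The bound secures three things: l < 0, so \<open>N s l\<close> is nonzero; l -
      d < L, so p is nonzero at \<open>X (l - d)\<close>; and l - d < 0, so
      \<open>N d (l - d)\<close> is nonzero. The argument is l - d because \<open>a\<close> shifts
      by d.\<close>
    fix l assume l: "l < min 0 (min L 0 + d)"
    let ?\<phi> = "\<lambda>m. if m = l + s then 1 else 0 :: complex"
    have "\<rho> (a \<otimes>\<^bsub>P\<^esub> c) ?\<phi> (l - d) = poly p (X (l - d)) * N d (l - d) * \<rho> c ?\<phi> l"
      using a(1) c ac' by (simp add: \<rho>_mult polyhom_def homog_def)
    moreover have "\<rho> (a \<otimes>\<^bsub>P\<^esub> c) ?\<phi> (l - d) = 0"
      using ac that(2) by (simp add: homog_def)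
    ultimately have "\<rho> c ?\<phi> l = 0"
      using L[of "l - d"] N_nz[of "l - d" d] l by (auto simp: min_def split: if_splits)
    also have "\<rho> c ?\<phi> l = poly (r s) (X l) * N s l"
      unfolding r using that(1) S by (simp add: if_distrib[of "\<lambda>x. _ * x"] cong: if_cong)
    finally show "poly (r s) (X l) = 0" using N_nz[of l s] l by auto
  qed
  have "\<rho> c \<phi> l = poly (if D - d \<in> S then r (D - d) else 0) (X l) * N (D - d) l * \<phi> (l + (D - d))" for \<phi> l
  proof -
    have "\<rho> c \<phi> l = (\<Sum>k\<in>S. if k = D - d then poly (r k) (X l) * N k l * \<phi> (l + k) else 0)"
      unfolding r using 0 by (intro sum.cong) auto
    also have "\<dots> = poly (if D - d \<in> S then r (D - d) else 0) (X l) * N (D - d) l * \<phi> (l + (D - d))"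
      using S by (subst sum.delta) auto
    finally show ?thesis .
  qed
  then show ?thesis unfolding polyhom_def homog_def using c by blast
qed

end

section \<open>Polynomial weights\<close>

text \<open>The disc relation after applying e, read on weights: \<open>A\<close> and
  \<open>A1\<close> belong to e(w) at l and l+1, \<open>G'\<close> and \<open>G\<close> to e(z) at
  l-1 and l, and \<open>a\<close>, \<open>b\<close> are \<alpha> and its inverse. With e(z) written
  as its inner value plus a defect \<open>u\<close>, the inner terms drop out and a recursion for
  the defect remains.\<close>

lemma e_relation_cancel:
  fixes a b :: complex
  assumes "A1 + G * (b * (1 - Y)) = Q * ((1 - x') * G' + A * a)" "x = Q * x'" "Y = Q * Y'"
    "A1 = b * t1 * (1 - Y) - (1 - x) * t0" "G' = u' + (a * t' - t0)" "G = u + (a * t0 - t1)"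
    "a * b = 1" "A = b * t0 * (1 - Y') - (1 - x') * t'"
  shows "b * (u * (1 - Y)) = Q * ((1 - x') * u')"
proof -
  have "b * (u * (1 - Y)) - Q * ((1 - x') * u') =
    A1 + G * (b * (1 - Y)) - Q * ((1 - x') * G' + A * a) + (1 - Q) * t0 * (1 - a * b)"
    unfolding assms(2-6) assms(8) by (simp add: algebra_simps)
  then show ?thesis using assms(1,7) by simp
qed

text \<open>The counterpart for f. Now f(z), with weights \<open>R0\<close> and \<open>R'\<close>,
  has its inner value exactly, and \<open>u\<close> is the defect of f(w), whose weights are
  \<open>V0\<close> and \<open>V1\<close>.\<close>

lemma f_relation_cancel:
  fixes a b :: complex
  assumes "R0 * (1 - Y) + b * V1 = Q * (V0 + a * ((1 - x') * R'))" "x = Q * x'" "Y = Q * Y'"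
    "V0 = u + (s0 * (1 - Y') - a * (1 - x') * s')" "V1 = u1 + (s1 * (1 - Y) - a * (1 - x) * s0)"
    "R' = s' - b * s0" "a * b = 1" "R0 = s0 - b * s1"
  shows "Q * u = b * u1"
proof -
  have "Q * u - b * u1 =
    Q * (V0 + a * ((1 - x') * R')) - (R0 * (1 - Y) + b * V1) + (1 - Q) * s0 * (1 - a * b)"
    unfolding assms(2-6) assms(8) by (simp add: algebra_simps)
  then show ?thesis using assms(1,7) by simp
qed

text \<open>\<open>D\<close> and \<open>D'\<close> are the weights of e(f(z)) and f(e(z)). The mixed
  products \<open>s0 * t3\<close> and \<open>t0 * s3\<close> cancel, so what survives groups into
  two consecutive values of one sequence.\<close>

lemma commutator_weight:
  fixes a b :: complex
  assumes "D - D' = C" "D = a * Y * t0 * (s2 - b * s3) - (s0 - b * s1) * t3"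
    "D' = s0 * (a * t2 - t3) - Y * b * (a * t0 - t1) * s3'" "s3 = s3'" "t3 = t3'"
    "c0 = Y * (t0 * s2) - t2 * s0" "c1 = Y * (t1 * s3') - t3' * s1"
  shows "a * c0 = b * c1 + C"
  unfolding assms(1)[symmetric] assms(2-) by (simp add: algebra_simps)

section \<open>q-difference equations for polynomials in \<open>X\<close>\<close>

context disc
begin

definition qpoly :: "(int \<Rightarrow> complex) \<Rightarrow> bool" where
  "qpoly g \<longleftrightarrow> (\<exists>p. \<forall>l. g l = poly p (X l))"

lemma qpoly_const: "qpoly (\<lambda>_. c)"
  unfolding qpoly_def by (intro exI[of _ "[:c:]"]) simp

lemma qpoly_X: "qpoly X"
  unfolding qpoly_def by (intro exI[of _ "[:0, 1:]"]) simp

lemma qpoly_add: "qpoly g \<Longrightarrow> qpoly h \<Longrightarrow> qpoly (\<lambda>l. g l + h l)"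
  unfolding qpoly_def by (metis poly_add)

lemma qpoly_diff: "qpoly g \<Longrightarrow> qpoly h \<Longrightarrow> qpoly (\<lambda>l. g l - h l)"
  unfolding qpoly_def by (metis poly_diff)

lemma qpoly_mult: "qpoly g \<Longrightarrow> qpoly h \<Longrightarrow> qpoly (\<lambda>l. g l * h l)"
  unfolding qpoly_def by (metis poly_mult)

lemma poly_shift: "poly p (X (l + s)) = poly (pcompose p [:0, X s:]) (X l)"
  by (simp add: poly_pcompose X_add)

lemma qpoly_shift: "qpoly g \<Longrightarrow> qpoly (\<lambda>l. g (l + s))"
  unfolding qpoly_def using poly_shift by metis

lemma qpoly_shift_minus: "qpoly g \<Longrightarrow> qpoly (\<lambda>l. g (l - s))"
  using qpoly_shift[of g "- s"] by simp

lemma qpoly_N: "qpoly (N k)"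
  using W_poly[of "nat (- k)" 0] by (simp add: qpoly_def N_def)

lemma qpoly_poly: "qpoly (\<lambda>l. poly p (X l))"
  by (auto simp: qpoly_def)

lemmas qpoly_intros = qpoly_const qpoly_add qpoly_diff qpoly_mult qpoly_N
  qpoly_X qpoly_shift[OF qpoly_X] qpoly_shift_minus[OF qpoly_X]
  qpoly_poly qpoly_shift[OF qpoly_poly]

lemma X_mult_nat: "X s ^ i = X (s * int i)"
  by (induction i) (simp_all add: X_add distrib_left mult.commute)

text \<open>Since X(l+s)^i = X(s i) X(l)^i, the difference operator is diagonal on monomials and the
  equation decouples into one scalar equation for each coefficient.\<close>

lemma qpoly_difference_coeff:
  assumes "\<And>l. l < L \<Longrightarrow> c * poly p (X l) = d * poly p (X (l + s)) + b"
  shows "c * coeff p i = d * X (s * int i) * coeff p i + (if i = 0 then b else 0)"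
proof -
  have "smult c p - (smult d (pcompose p [:0, X s:]) + [:b:]) = 0"
    using assms by (intro poly_X_zero[of L]) (simp add: poly_shift[symmetric])
  then have "coeff (smult c p) i = coeff (smult d (pcompose p [:0, X s:]) + [:b:]) i"
    by simp
  moreover have "coeff [:b:] i = (if i = 0 then b else 0)" by (cases i) simp_all
  ultimately show ?thesis
    by (simp add: coeff_pcompose_linear X_mult_nat mult_ac split del: if_split)
qed

text \<open>The inhomogeneity \<open>b\<close> enters only the constant coefficient, so
  non-resonance for i > 0 kills all the others.\<close>

lemma qpoly_constant:
  assumes "qpoly g" "\<And>l. l < L \<Longrightarrow> c * g l = d * g (l + s) + b"
    and "\<And>i::nat. i > 0 \<Longrightarrow> c \<noteq> d * X (s * int i)"
  shows "g l = g m"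
proof -
  obtain p where p: "\<And>l. g l = poly p (X l)" using assms(1) by (auto simp: qpoly_def)
  have "coeff p i = 0" if "i > 0" for i
    using qpoly_difference_coeff[of L c p d s b i] assms(2) assms(3)[OF that] that
    by (simp add: p)
  then have "degree p = 0" by (metis bot_nat_0.not_eq_extremum degree_0 leading_coeff_0_iff)
  then show ?thesis by (elim degree_eq_zeroE) (simp add: p)
qed

lemma qpoly_zero:
  assumes "qpoly g" "\<And>l. l < L \<Longrightarrow> c * g l = d * g (l + s)"
    and "\<And>i::nat. c \<noteq> d * X (s * int i)"
  shows "g l = 0"
proof -
  obtain p where p: "\<And>l. g l = poly p (X l)" using assms(1) by (auto simp: qpoly_def)
  have "coeff p i = 0" for i
    using qpoly_difference_coeff[of L c p d s 0 i] assms(2) assms(3)[of i] by (simp add: p split: if_splits)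
  then have "p = 0" by (simp add: poly_eq_iff)
  then show ?thesis by (simp add: p)
qed

lemma qpoly_zero_if:
  assumes "qpoly g" "\<And>l. l < L \<Longrightarrow> g l = 0"
  shows "g l = 0"
  using assms poly_X_zero[of L] by (force simp: qpoly_def)

text \<open>In the absence of resonance each coefficient of \<open>h\<close> is divided by its
  scalar c - d X(s i).\<close>

lemma qpoly_solve:
  assumes "qpoly h" and c: "\<And>i::nat. c \<noteq> d * X (s * int i)"
  obtains g where "qpoly g" "\<And>l. c * g l - d * g (l + s) = h l"
proof -
  obtain p where p: "\<And>l. h l = poly p (X l)" using assms(1) by (auto simp: qpoly_def)
  define r where "r = (\<Sum>i\<le>degree p. monom (coeff p i / (c - d * X (s * int i))) i)"
  have "coeff r i = (if i \<le> degree p then coeff p i / (c - d * X (s * int i)) else 0)" for i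
    unfolding r_def by (simp add: coeff_sum)
  then have r: "coeff r i = coeff p i / (c - d * X (s * int i))" for i
    by (simp add: coeff_eq_0)
  have "smult c r - smult d (pcompose r [:0, X s:]) = p"
  proof (rule poly_eqI)
    fix i
    have "(c - d * X (s * int i)) * coeff r i = coeff p i"
      using c[of i] by (simp add: r)
    then show "coeff (smult c r - smult d (pcompose r [:0, X s:])) i = coeff p i"
      by (simp add: coeff_pcompose_linear X_mult_nat algebra_simps)
  qed
  then have "c * poly r (X l) - d * poly r (X (l + s)) = h l" for l
    unfolding p poly_shift by (metis poly_diff poly_smult)
  then show ?thesis using that[of "\<lambda>l. poly r (X l)"] by (auto simp: qpoly_def)
qed

lemma grade_homog:
  assumes "a \<in> disc_grade q k"
  obtains g where "qpoly g" "homog k (\<lambda>l. g l * N k l) a"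
proof -
  obtain p where "polyhom k p a" using grade_polyhom[OF assms] by blast
  then show ?thesis using that[of "\<lambda>l. poly p (X l)"] by (auto simp: polyhom_def qpoly_def)
qed

end


section \<open>Symmetries of the quantum disc with negative grading jump\<close>

text \<open>Here the Hopf algebra has disappeared: what is left are four linear maps with their
  relations and Leibniz rules. \<open>m\<close> is minus the grading jump, so e lowers and f raises
  degrees.\<close>

locale disc_action = disc q for q +
  fixes e f k ki :: "(disc_gen list \<Rightarrow>\<^sub>0 complex) set \<Rightarrow> (disc_gen list \<Rightarrow>\<^sub>0 complex) set" and m :: int
  assumes m: "m \<ge> 2"
    and closed [simp]: "\<And>a. a \<in> carrier P \<Longrightarrow> e a \<in> carrier P" "\<And>a. a \<in> carrier P \<Longrightarrow> f a \<in> carrier P"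
      "\<And>a. a \<in> carrier P \<Longrightarrow> k a \<in> carrier P" "\<And>a. a \<in> carrier P \<Longrightarrow> ki a \<in> carrier P"
    and add: "\<And>a b. a \<in> carrier P \<Longrightarrow> b \<in> carrier P \<Longrightarrow> e (a \<oplus>\<^bsub>P\<^esub> b) = e a \<oplus>\<^bsub>P\<^esub> e b"
      "\<And>a b. a \<in> carrier P \<Longrightarrow> b \<in> carrier P \<Longrightarrow> f (a \<oplus>\<^bsub>P\<^esub> b) = f a \<oplus>\<^bsub>P\<^esub> f b"
      "\<And>a b. a \<in> carrier P \<Longrightarrow> b \<in> carrier P \<Longrightarrow> k (a \<oplus>\<^bsub>P\<^esub> b) = k a \<oplus>\<^bsub>P\<^esub> k b"
      "\<And>a b. a \<in> carrier P \<Longrightarrow> b \<in> carrier P \<Longrightarrow> ki (a \<oplus>\<^bsub>P\<^esub> b) = ki a \<oplus>\<^bsub>P\<^esub> ki b"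
    and smult: "\<And>a c. a \<in> carrier P \<Longrightarrow> e (c \<odot>\<^bsub>P\<^esub> a) = c \<odot>\<^bsub>P\<^esub> e a"
      "\<And>a c. a \<in> carrier P \<Longrightarrow> f (c \<odot>\<^bsub>P\<^esub> a) = c \<odot>\<^bsub>P\<^esub> f a"
      "\<And>a c. a \<in> carrier P \<Longrightarrow> k (c \<odot>\<^bsub>P\<^esub> a) = c \<odot>\<^bsub>P\<^esub> k a"
      "\<And>a c. a \<in> carrier P \<Longrightarrow> ki (c \<odot>\<^bsub>P\<^esub> a) = c \<odot>\<^bsub>P\<^esub> ki a"
    and ki_k: "\<And>a. a \<in> carrier P \<Longrightarrow> ki (k a) = a" and k_ki: "\<And>a. a \<in> carrier P \<Longrightarrow> k (ki a) = a"
    and k_e: "\<And>a. a \<in> carrier P \<Longrightarrow> k (e a) = q\<^sup>2 \<odot>\<^bsub>P\<^esub> e (k a)"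
    and k_f: "\<And>a. a \<in> carrier P \<Longrightarrow> k (f a) = (1 / q\<^sup>2) \<odot>\<^bsub>P\<^esub> f (k a)"
    and e_f: "\<And>a. a \<in> carrier P \<Longrightarrow> e (f a) \<ominus>\<^bsub>P\<^esub> f (e a)
      = (1 / (q - 1 / q)) \<odot>\<^bsub>P\<^esub> k a \<ominus>\<^bsub>P\<^esub> (1 / (q - 1 / q)) \<odot>\<^bsub>P\<^esub> ki a"
    and k_mult: "\<And>a b. a \<in> carrier P \<Longrightarrow> b \<in> carrier P \<Longrightarrow> k (a \<otimes>\<^bsub>P\<^esub> b) = k a \<otimes>\<^bsub>P\<^esub> k b"
    and e_mult: "\<And>a b. a \<in> carrier P \<Longrightarrow> b \<in> carrier P \<Longrightarrow> e (a \<otimes>\<^bsub>P\<^esub> b) = a \<otimes>\<^bsub>P\<^esub> e b \<oplus>\<^bsub>P\<^esub> e a \<otimes>\<^bsub>P\<^esub> k b"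
    and f_mult: "\<And>a b. a \<in> carrier P \<Longrightarrow> b \<in> carrier P \<Longrightarrow> f (a \<otimes>\<^bsub>P\<^esub> b) = f a \<otimes>\<^bsub>P\<^esub> b \<oplus>\<^bsub>P\<^esub> ki a \<otimes>\<^bsub>P\<^esub> f b"
    and e_grade: "\<And>a j. a \<in> disc_grade q j \<Longrightarrow> e a \<in> disc_grade q (j - m)"
    and f_grade: "\<And>a j. a \<in> disc_grade q j \<Longrightarrow> f a \<in> disc_grade q (j + m)"
    and nontrivial: "\<exists>a\<in>carrier P. e a \<noteq> \<zero>\<^bsub>P\<^esub> \<or> f a \<noteq> \<zero>\<^bsub>P\<^esub>"
begin

abbreviation "\<kappa> \<equiv> 1 / (q - 1 / q)"

lemma q4: "q ^ 4 \<noteq> 1" and kappa_nz: "\<kappa> \<noteq> 0"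
  using not_root[of 2] not_root[of 4] q by (auto simp: field_simps power2_eq_square)

lemma smult_eq_zero:
  assumes "a \<in> carrier P" "c \<odot>\<^bsub>P\<^esub> a = \<zero>\<^bsub>P\<^esub>" "c \<noteq> 0"
  shows "a = \<zero>\<^bsub>P\<^esub>"
  using P.smult_smult[of a "1 / c" c] assms by (simp add: P.one_smult P.smult_zero)

lemma smult_cancel:
  assumes "a \<in> carrier P" "c \<odot>\<^bsub>P\<^esub> a = d \<odot>\<^bsub>P\<^esub> a" "a \<noteq> \<zero>\<^bsub>P\<^esub>"
  shows "c = d"
proof -
  have "(c - d) \<odot>\<^bsub>P\<^esub> a = c \<odot>\<^bsub>P\<^esub> a \<ominus>\<^bsub>P\<^esub> d \<odot>\<^bsub>P\<^esub> a"
    using assms(1) P.add_smult[of a c "- d"] by (simp add: P.uminus_smult a_minus_def)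
  also have "\<dots> = \<zero>\<^bsub>P\<^esub>" using assms by (simp add: P.minus_eq_zero_iff)
  finally show ?thesis using smult_eq_zero[OF assms(1)] assms(3) by fastforce
qed

text \<open>If \<open>e = 0\<close>, then \<open>k\<^sup>2 = 1\<close>, which forces \<open>f = q\<^sup>-\<^sup>4 f\<close>.\<close>

lemma e_nontrivial: "\<exists>a\<in>carrier P. e a \<noteq> \<zero>\<^bsub>P\<^esub>"
proof (rule ccontr)
  assume "\<not> ?thesis"
  then have e0: "e a = \<zero>\<^bsub>P\<^esub>" if "a \<in> carrier P" for a using that by blast
  have f0: "f \<zero>\<^bsub>P\<^esub> = \<zero>\<^bsub>P\<^esub>"
    using smult(2)[of "\<one>\<^bsub>P\<^esub>" 0] by (simp add: P.zero_smult)
  have "k a = ki a" if a: "a \<in> carrier P" for a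
  proof -
    have "\<kappa> \<odot>\<^bsub>P\<^esub> k a \<ominus>\<^bsub>P\<^esub> \<kappa> \<odot>\<^bsub>P\<^esub> ki a = \<zero>\<^bsub>P\<^esub>"
      using e_f[OF a] a by (simp add: e0 f0 a_minus_def)
    then have "\<kappa> \<odot>\<^bsub>P\<^esub> k a = \<kappa> \<odot>\<^bsub>P\<^esub> ki a" using a by (simp add: P.minus_eq_zero_iff)
    then have "(1 / \<kappa>) \<odot>\<^bsub>P\<^esub> (\<kappa> \<odot>\<^bsub>P\<^esub> k a) = (1 / \<kappa>) \<odot>\<^bsub>P\<^esub> (\<kappa> \<odot>\<^bsub>P\<^esub> ki a)" by simp
    then show ?thesis using a kappa_nz by (simp add: P.smult_smult P.one_smult)
  qed
  then have kk: "k (k a) = a" if "a \<in> carrier P" for a using that k_ki by simp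
  have "f a = \<zero>\<^bsub>P\<^esub>" if a: "a \<in> carrier P" for a
  proof (rule ccontr)
    assume "f a \<noteq> \<zero>\<^bsub>P\<^esub>"
    have "1 \<odot>\<^bsub>P\<^esub> f a = k (k (f a))" using a kk by (simp add: P.one_smult)
    also have "\<dots> = (1 / q ^ 4) \<odot>\<^bsub>P\<^esub> f a"
      using a kk by (simp add: k_f smult P.smult_smult)
    finally have "1 \<odot>\<^bsub>P\<^esub> f a = (1 / q ^ 4) \<odot>\<^bsub>P\<^esub> f a" .
    from smult_cancel[OF closed(2)[OF a] this \<open>f a \<noteq> \<zero>\<^bsub>P\<^esub>\<close>] have "1 = 1 / q ^ 4" .
    then show False using q4 q by simp
  qed
  then show False using nontrivial e0 by blast
qed

section \<open>The automorphism \<open>k\<close> is diagonal for the grading\<close>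

lemma k_one: "k \<one>\<^bsub>P\<^esub> = \<one>\<^bsub>P\<^esub>"
  using k_mult[of "\<one>\<^bsub>P\<^esub>" "ki \<one>\<^bsub>P\<^esub>"] by (simp add: k_ki)

lemma ki_one: "ki \<one>\<^bsub>P\<^esub> = \<one>\<^bsub>P\<^esub>"
  using ki_k[of "\<one>\<^bsub>P\<^esub>"] by (simp add: k_one)

text \<open>The Leibniz rule for 1 = 1 1 reads e(1) = e(1) + e(1).\<close>

lemma e_one: "e \<one>\<^bsub>P\<^esub> = \<zero>\<^bsub>P\<^esub>"
  using e_mult[of "\<one>\<^bsub>P\<^esub>" "\<one>\<^bsub>P\<^esub>"] by (simp add: k_one P.add.r_cancel_one')

lemma f_one: "f \<one>\<^bsub>P\<^esub> = \<zero>\<^bsub>P\<^esub>"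
  using f_mult[of "\<one>\<^bsub>P\<^esub>" "\<one>\<^bsub>P\<^esub>"] by (simp add: ki_one P.add.r_cancel_one')

lemma ki_mult:
  assumes "a \<in> carrier P" "b \<in> carrier P"
  shows "ki (a \<otimes>\<^bsub>P\<^esub> b) = ki a \<otimes>\<^bsub>P\<^esub> ki b"
  using k_mult[of "ki a" "ki b"] ki_k[of "ki a \<otimes>\<^bsub>P\<^esub> ki b"] assms by (simp add: k_ki)

text \<open>By the Leibniz rule, a map e that kills both generators kills everything.\<close>

lemma e_gen_nontrivial: "\<exists>g. e (gen (disc_rels q) g) \<noteq> \<zero>\<^bsub>P\<^esub>"
proof (rule ccontr)
  assume n: "\<not> ?thesis"
  have "e a = \<zero>\<^bsub>P\<^esub>" if "a \<in> carrier P" for a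
    using that by (induction rule: presented_induct)
      (use n in \<open>simp_all add: e_one add smult e_mult P.smult_zero\<close>)
  then show False using e_nontrivial by blast
qed

definition gen_degree :: "disc_gen \<Rightarrow> int" where
  "gen_degree g = (case g of Z \<Rightarrow> 1 | Zstar \<Rightarrow> - 1)"

lemma gen_grade: "gen (disc_rels q) g \<in> disc_grade q (gen_degree g)"
  using zw_in_grade[of 1 0] zw_in_grade[of 0 1] by (cases g) (simp_all add: zw_def gen_degree_def)

lemma gen_mult_grade:
  "gen (disc_rels q) g \<otimes>\<^bsub>P\<^esub> gen (disc_rels q) h \<in> disc_grade q (gen_degree g + gen_degree h)"
proof -
  have "w \<otimes>\<^bsub>P\<^esub> z \<in> disc_grade q 0"
    unfolding w_z_relation using zw_in_grade[of 1 1] zw_in_grade[of 0 0]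
    unfolding disc_grade_eq by (intro P.lin_span_add P.lin_span_smult) (simp_all add: zw_def)
  moreover have "z \<otimes>\<^bsub>P\<^esub> z \<in> disc_grade q 2" "w \<otimes>\<^bsub>P\<^esub> w \<in> disc_grade q (- 2)" "z \<otimes>\<^bsub>P\<^esub> w \<in> disc_grade q 0"
    using zw_in_grade[of 2 0] zw_in_grade[of 0 2] zw_in_grade[of 1 1]
    by (simp_all add: zw_def numeral_2_eq_2)
  ultimately show ?thesis by (cases g; cases h) (simp_all add: gen_degree_def)
qed

text \<open>The left factor in \<open>homog_factor\<close> must be nonzero, so it is e(g) for a
  generator g not killed by e; the generator h remains arbitrary.\<close>

lemma k_gen_polyhom: "\<exists>p. polyhom (gen_degree h) p (k (gen (disc_rels q) h))"
proof -
  let ?x = "gen (disc_rels q)"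
  obtain g where g: "e (?x g) \<noteq> \<zero>\<^bsub>P\<^esub>" using e_gen_nontrivial by blast
  let ?D = "gen_degree g + gen_degree h - m"
  obtain u where u: "homog ?D u (e (?x g \<otimes>\<^bsub>P\<^esub> ?x h))"
    using grade_homog[OF e_grade[OF gen_mult_grade]] by blast
  obtain v where v: "homog (gen_degree g) v (?x g)" using grade_homog[OF gen_grade] by blast
  obtain v' where v': "homog (gen_degree h - m) v' (e (?x h))"
    using grade_homog[OF e_grade[OF gen_grade]] by blast
  have "e (?x g) \<otimes>\<^bsub>P\<^esub> k (?x h) = e (?x g \<otimes>\<^bsub>P\<^esub> ?x h) \<ominus>\<^bsub>P\<^esub> ?x g \<otimes>\<^bsub>P\<^esub> e (?x h)"
    by (simp add: e_mult P.add_minus_cancel)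
  moreover have "homog ?D (\<lambda>l. u l - v l * v' (l + gen_degree g)) (e (?x g \<otimes>\<^bsub>P\<^esub> ?x h) \<ominus>\<^bsub>P\<^esub> ?x g \<otimes>\<^bsub>P\<^esub> e (?x h))"
    using homog_mult[OF v v'] by (intro homog_minus u) (simp add: algebra_simps)
  ultimately obtain u' where "homog ?D u' (e (?x g) \<otimes>\<^bsub>P\<^esub> k (?x h))" by metis
  moreover obtain p where "polyhom (gen_degree g - m) p (e (?x g))"
    using grade_polyhom[OF e_grade[OF gen_grade]] by blast
  ultimately show ?thesis
    using homog_factor[of "k (?x h)" "gen_degree g - m" p "e (?x g)" ?D u'] g
    by (simp add: algebra_simps)
qed

text \<open>Applying k to the disc relation gives a recursion that forces p(x) r(q^2 x) = 1. Then p
  is a unit among polynomials, hence a constant, and r is its inverse.\<close>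

lemma k_diagonal: "\<exists>\<alpha>. \<alpha> \<noteq> 0 \<and> k z = \<alpha> \<odot>\<^bsub>P\<^esub> z \<and> k w = (1 / \<alpha>) \<odot>\<^bsub>P\<^esub> w"
proof -
  obtain p where "polyhom 1 p (k z)" using k_gen_polyhom[of Z] by (auto simp: gen_degree_def)
  then have kz: "homog 1 (\<lambda>l. poly p (X l)) (k z)" by (simp add: polyhom_def)
  obtain r where "polyhom (- 1) r (k w)" using k_gen_polyhom[of Zstar] by (auto simp: gen_degree_def)
  then have kw: "homog (- 1) (\<lambda>l. poly r (X l) * (1 - X (l - 1))) (k w)"
    by (simp add: polyhom_def N_def W_def)
  \<comment> \<open>Once \<open>M\<close> vanishes, the polynomial parts of the weights of k(z) and
    k(w) are mutually inverse up to a shift of the argument.\<close>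
  define M where "M l = poly p (X l) * poly r (X (l + 1)) - 1" for l
  define S where "S l = M l * (1 - X l)" for l \<comment> \<open>satisfies \<open>S l = q\<^sup>2 S (l - 1)\<close> and vanishes at \<open>0\<close>\<close>
  have "k z \<otimes>\<^bsub>P\<^esub> k w = q\<^sup>2 \<odot>\<^bsub>P\<^esub> (k w \<otimes>\<^bsub>P\<^esub> k z) \<oplus>\<^bsub>P\<^esub> (1 - q\<^sup>2) \<odot>\<^bsub>P\<^esub> \<one>\<^bsub>P\<^esub>"
    using arg_cong[OF disc_relation, of k] by (simp add: k_mult add smult k_one)
  then have "\<rho> (k z \<otimes>\<^bsub>P\<^esub> k w) (\<lambda>_. 1) l
      = \<rho> (q\<^sup>2 \<odot>\<^bsub>P\<^esub> (k w \<otimes>\<^bsub>P\<^esub> k z) \<oplus>\<^bsub>P\<^esub> (1 - q\<^sup>2) \<odot>\<^bsub>P\<^esub> \<one>\<^bsub>P\<^esub>) (\<lambda>_. 1) l" for l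
    by simp
  then have rel: "poly p (X l) * (poly r (X (l + 1)) * (1 - X l))
    = q\<^sup>2 * (poly r (X l) * (1 - X (l - 1)) * poly p (X (l - 1))) + (1 - q\<^sup>2)" for l
    using kz kw by (simp add: homog_def \<rho>_add \<rho>_mult \<rho>_smult \<rho>_one)
  have S_step: "S l = q\<^sup>2 * S (l - 1)" for l
  proof -
    have "X l = X (l - 1) * q\<^sup>2" using X_add[of "l - 1" 1] by (simp add: X_1)
    then show ?thesis using rel[of l] by (simp add: S_def M_def algebra_simps)
  qed
  have S0: "S l = 0" if "l \<le> 0" for l
    using that
  proof (induction l rule: int_le_induct)
    case base
    show ?case by (simp add: S_def)
  next
    case (step l)
    then show ?case using S_step[of l] q by simp
  qed
  \<comment> \<open>The recursion, run to the left from S(0) = 0, gives S = 0 for l \<le> 0; for l <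
    0 the factor 1 - X l may be divided out.\<close>
  then have "M l = 0" if "l < 0" for l using that S0[of l] by (auto simp: S_def)
  moreover have "qpoly M" unfolding M_def by (intro qpoly_intros)
  ultimately have "M l = 0" for l using qpoly_zero_if[of M 0] by blast
  then have pr: "poly p (X l) * poly r (X (l + 1)) = 1" for l by (simp add: M_def)
  have "p * pcompose r [:0, X 1:] - 1 = 0"
    using pr by (intro poly_X_zero[of 0]) (simp add: poly_shift)
  then have "p dvd 1" by (intro dvdI[of _ _ "pcompose r [:0, X 1:]"]) simp
  then obtain \<alpha> where \<alpha>: "p = [:\<alpha>:]" by (auto simp: is_unit_poly_iff)
  have nz: "\<alpha> \<noteq> 0" using pr[of 0] by (auto simp: \<alpha>)
  have r: "poly r (X l) = 1 / \<alpha>" for l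
    using pr[of "l - 1"] nz by (simp add: \<alpha> field_simps)
  have "k z = \<alpha> \<odot>\<^bsub>P\<^esub> z"
    by (rule homog_eqI[OF kz homog_smult[OF homog_z]]) (simp add: \<alpha>)
  moreover have "k w = (1 / \<alpha>) \<odot>\<^bsub>P\<^esub> w"
    by (rule homog_eqI[OF kw homog_smult[OF homog_w]]) (simp add: r)
  ultimately show ?thesis using nz by blast
qed

definition \<alpha> :: complex where
  "\<alpha> = (SOME \<alpha>. \<alpha> \<noteq> 0 \<and> k z = \<alpha> \<odot>\<^bsub>P\<^esub> z \<and> k w = (1 / \<alpha>) \<odot>\<^bsub>P\<^esub> w)"

lemma \<alpha>_nz [simp]: "\<alpha> \<noteq> 0" and k_z: "k z = \<alpha> \<odot>\<^bsub>P\<^esub> z" and k_w: "k w = (1 / \<alpha>) \<odot>\<^bsub>P\<^esub> w"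
  using someI_ex[OF k_diagonal] unfolding \<alpha>_def[symmetric] by blast+

lemma k_grade:
  assumes "a \<in> disc_grade q j"
  shows "k a = (\<alpha> powi j) \<odot>\<^bsub>P\<^esub> a"
proof -
  have kz: "k (z [^]\<^bsub>P\<^esub> i) = (\<alpha> ^ i) \<odot>\<^bsub>P\<^esub> z [^]\<^bsub>P\<^esub> i" for i :: nat
    by (induction i) (simp_all add: k_one k_mult k_z P.one_smult P.smult_mult P.mult_smult P.smult_smult mult.commute)
  have kw: "k (w [^]\<^bsub>P\<^esub> i) = ((1 / \<alpha>) ^ i) \<odot>\<^bsub>P\<^esub> w [^]\<^bsub>P\<^esub> i" for i :: nat
    by (induction i) (simp_all add: k_one k_mult k_w P.one_smult P.smult_mult P.mult_smult P.smult_smult mult.commute)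
  have "k (zw (i, l)) = (\<alpha> powi (int i - int l)) \<odot>\<^bsub>P\<^esub> zw (i, l)" for i l
    by (simp add: zw_def k_mult kz kw P.smult_mult P.mult_smult P.smult_smult power_int_diff power_one_over)
  moreover have "k \<zero>\<^bsub>P\<^esub> = \<zero>\<^bsub>P\<^esub>"
    using smult(3)[of "\<one>\<^bsub>P\<^esub>" 0] by (simp add: P.zero_smult)
  moreover note assms[unfolded disc_grade_eq]
  ultimately have "a \<in> {a \<in> carrier P. k a = (\<alpha> powi j) \<odot>\<^bsub>P\<^esub> a}"
    by (elim P.lin_span_induct)
      (auto simp: add smult P.smult_add P.smult_smult mult.commute P.smult_zero simp del: set_eq_iff)
  then show ?thesis by simp
qed

lemma ki_grade:
  assumes "a \<in> disc_grade q j"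
  shows "ki a = (\<alpha> powi (- j)) \<odot>\<^bsub>P\<^esub> a"
proof -
  have a: "a \<in> carrier P" using assms by (rule grade_closed)
  have "ki a = (\<alpha> powi (- j)) \<odot>\<^bsub>P\<^esub> ki ((\<alpha> powi j) \<odot>\<^bsub>P\<^esub> a)"
    using a by (simp add: smult P.smult_smult P.one_smult power_int_minus)
  then show ?thesis using a by (simp add: k_grade[OF assms, symmetric] ki_k)
qed

lemma ki_z: "ki z = (1 / \<alpha>) \<odot>\<^bsub>P\<^esub> z" and ki_w: "ki w = \<alpha> \<odot>\<^bsub>P\<^esub> w"
  using ki_grade[OF gen_grade[of Z]] ki_grade[OF gen_grade[of Zstar]]
  by (simp_all add: gen_degree_def power_int_minus divide_inverse)

section \<open>Non-resonance of the eigenvalue \<alpha>\<close>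

lemma \<alpha>_m: "\<alpha> powi m = X (- 1)"
proof -
  obtain g where g: "e (gen (disc_rels q) g) \<noteq> \<zero>\<^bsub>P\<^esub>" using e_gen_nontrivial by blast
  let ?b = "gen (disc_rels q) g"
  have "(\<alpha> powi (gen_degree g - m)) \<odot>\<^bsub>P\<^esub> e ?b = k (e ?b)"
    by (rule k_grade[symmetric]) (intro e_grade gen_grade)
  also have "\<dots> = (q\<^sup>2 * \<alpha> powi gen_degree g) \<odot>\<^bsub>P\<^esub> e ?b"
    by (simp add: k_e k_grade[OF gen_grade] smult P.smult_smult)
  finally have "\<alpha> powi (gen_degree g - m) = q\<^sup>2 * \<alpha> powi gen_degree g"
    using smult_cancel[OF _ _ g] by simp
  then have "\<alpha> powi m = 1 / q\<^sup>2" using q by (simp add: power_int_diff field_simps)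
  also have "1 / q\<^sup>2 = X (- 1)" using X_add[of "- 1" 1] q by (simp add: X_1 field_simps)
  finally show ?thesis .
qed

lemma X_powi: "X i powi j = X (i * j)"
  using q by (simp add: X_def power_int_mult[symmetric] mult.assoc)

lemma \<alpha>_neq_X: "\<alpha> \<noteq> X i"
proof
  assume "\<alpha> = X i"
  then have "X (i * m) = X (- 1)" using \<alpha>_m by (simp add: X_powi)
  then have "i * m = - 1" using inj_X by (simp add: inj_eq)
  then have "m dvd 1" by (metis dvd_minus_iff dvd_triv_right)
  then show False using m by simp
qed

text \<open>The m-th power would give i m = -2, excluded by the sign of i. The restriction matters:
  for m = 2 the square of \<alpha> is q^(-2).\<close>

lemma \<alpha>2_neq_X: "i \<ge> 0 \<Longrightarrow> \<alpha>\<^sup>2 \<noteq> X i"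
proof
  assume i: "i \<ge> 0" and "\<alpha>\<^sup>2 = X i"
  then have "X (i * m) = (\<alpha>\<^sup>2) powi m" by (simp add: X_powi)
  also have "\<dots> = (\<alpha> powi m)\<^sup>2" by (simp add: power2_eq_square power_int_mult_distrib)
  also have "\<dots> = X (- 2)" using X_add[of "- 1" "- 1"] by (simp add: \<alpha>_m power2_eq_square)
  finally have "i * m = - 2" using inj_X by (simp add: inj_eq)
  then show False using i m by (smt (verit) mult_nonneg_nonneg)
qed

text \<open>The map sending a to T k(a) - a T obeys the same twisted Leibniz rule as e, for any
  linear operator T. Agreement on the generators therefore suffices.\<close>

lemma e_inner:
  assumes T: "linear_op T"
    and gens: "\<And>g \<phi>. \<rho> (e (gen (disc_rels q) g)) \<phi>
      = (\<lambda>l. T (\<rho> (k (gen (disc_rels q) g)) \<phi>) l - \<rho> (gen (disc_rels q) g) (T \<phi>) l)"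
    and "a \<in> carrier P"
  shows "\<rho> (e a) \<phi> = (\<lambda>l. T (\<rho> (k a) \<phi>) l - \<rho> a (T \<phi>) l)"
  using assms(3)
proof (induction arbitrary: \<phi> rule: presented_induct)
  case (gen g)
  show ?case by (rule gens)
next
  case one
  then show ?case by (simp add: e_one k_one \<rho>_one \<rho>_zero fun_eq_iff)
next
  case (add x y)
  then show ?case
    by (simp add: disc_action.add[OF disc_action_axioms] \<rho>_add_fun fun_eq_iff linear_opD[OF T])
next
  case (smult c x)
  then show ?case
    by (simp add: disc_action.smult[OF disc_action_axioms] \<rho>_smult_fun fun_eq_iff linear_opD[OF T] right_diff_distrib)
next
  case (mult x y)
  then show ?case
    by (intro ext) (simp add: e_mult k_mult \<rho>_add \<rho>_mult linear_opD[OF \<rho>_linear])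
qed

lemma f_inner:
  assumes T: "linear_op T"
    and gens: "\<And>g \<phi>. \<rho> (f (gen (disc_rels q) g)) \<phi>
      = (\<lambda>l. T (\<rho> (gen (disc_rels q) g) \<phi>) l - \<rho> (ki (gen (disc_rels q) g)) (T \<phi>) l)"
    and "a \<in> carrier P"
  shows "\<rho> (f a) \<phi> = (\<lambda>l. T (\<rho> a \<phi>) l - \<rho> (ki a) (T \<phi>) l)"
  using assms(3)
proof (induction arbitrary: \<phi> rule: presented_induct)
  case (gen g)
  show ?case by (rule gens)
next
  case one
  then show ?case by (simp add: f_one ki_one \<rho>_one \<rho>_zero fun_eq_iff)
next
  case (add x y)
  then show ?case
    by (simp add: disc_action.add[OF disc_action_axioms] \<rho>_add_fun fun_eq_iff linear_opD[OF T])
next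
  case (smult c x)
  then show ?case
    by (simp add: disc_action.smult[OF disc_action_axioms] \<rho>_smult_fun fun_eq_iff linear_opD[OF T] right_diff_distrib)
next
  case (mult x y)
  then show ?case
    by (intro ext) (simp add: f_mult ki_mult \<rho>_add \<rho>_mult linear_opD[OF \<rho>_linear])
qed

text \<open>Each product is opened at its last and at its first factor. Terms at l and at l - 1
  thereby acquire a common factor that can be cancelled.\<close>

lemma N_step: "N (- m) l = N (1 - m) l * (1 - X (l - m))" "N (- m) l = (1 - X (l - 1)) * N (1 - m) (l - 1)"
  "N (- 1 - m) l = N (- m) l * (1 - X (l - m - 1))" "N (- 1 - m) l = (1 - X (l - 1)) * N (- m) (l - 1)"
proof -
  have 1: "nat (- (- m)) = Suc (nat (m - 1))" "nat (- (1 - m)) = nat (m - 1)" "nat (- (- 1 - m)) = Suc (nat m)"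
    using m by auto
  have 2: "W (Suc j) l = (1 - X (l - 1)) * W j (l - 1)" for j
    using W_add[of 1 j l] by (simp add: W_def)
  show "N (- m) l = N (1 - m) l * (1 - X (l - m))"
    unfolding N_def 1 W_Suc using m by simp
  show "N (- 1 - m) l = N (- m) l * (1 - X (l - m - 1))"
    unfolding N_def 1(3) W_Suc using m by (simp add: algebra_simps)
  show "N (- m) l = (1 - X (l - 1)) * N (1 - m) (l - 1)"
    unfolding N_def 1 2 by simp
  show "N (- 1 - m) l = (1 - X (l - 1)) * N (- m) (l - 1)"
    unfolding N_def 1(3) 2 by simp
qed

text \<open>The weight \<open>t\<close> is fitted to e(w) alone; the disc relation then leaves e(z)
  no freedom.\<close>

lemma e_weight_exists:
  obtains t where "qpoly t" "t 1 = 0"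
    "\<And>a \<phi> l. a \<in> carrier P \<Longrightarrow> \<rho> (e a) \<phi> l = t l * \<rho> (k a) \<phi> (l - m) - \<rho> a (\<lambda>i. t i * \<phi> (i - m)) l"
proof -
  obtain Q where Q: "qpoly Q" "homog (- 1 - m) (\<lambda>l. Q l * N (- 1 - m) l) (e w)"
    using grade_homog[OF e_grade[OF gen_grade[of Zstar]]] by (auto simp: gen_degree_def)
  obtain R where R: "qpoly R" "homog (1 - m) (\<lambda>l. R l * N (1 - m) l) (e z)"
    using grade_homog[OF e_grade[OF gen_grade[of Z]]] by (auto simp: gen_degree_def)
  \<comment> \<open>Both terms in the weight of T k(w) - w T contain \<open>N (- 1 - m)\<close>.
    After cancelling it, the equation for the polynomial part is \<tau>(l) / \<alpha> - \<tau>(l-1)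
    = Q(l), with resonance only at \<alpha> = q^(2i).\<close>
  have "1 / \<alpha> \<noteq> 1 * X (- 1 * int i)" for i
    using \<alpha>_neq_X[of "int i"] by (auto simp: X_minus field_simps)
  from qpoly_solve[OF Q(1) this] obtain \<tau> where
    \<tau>: "qpoly \<tau>" "\<And>l. 1 / \<alpha> * \<tau> l - 1 * \<tau> (l + - 1) = Q l" by blast
  define t where "t l = \<tau> l * N (- m) l" for l
  define T where "T \<phi> l = t l * \<phi> (l - m)" for \<phi> :: "int \<Rightarrow> complex" and l
  have tq: "qpoly t" unfolding t_def by (intro qpoly_intros \<tau>(1))
  \<comment> \<open>At l = 1 the first factor of \<open>N (- m)\<close> is 1 - X 0.\<close>
  have t1: "t 1 = 0"
    using N_step(2)[of 1] by (simp add: t_def)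
  have T: "linear_op T" by (simp add: linear_op_def T_def fun_eq_iff algebra_simps)
  have ew: "Q l * N (- 1 - m) l = 1 / \<alpha> * t l * (1 - X (l - m - 1)) - (1 - X (l - 1)) * t (l - 1)" for l
  proof -
    have "Q l * N (- 1 - m) l = 1 / \<alpha> * \<tau> l * N (- 1 - m) l - \<tau> (l - 1) * N (- 1 - m) l"
      using \<tau>(2)[of l] by (simp add: algebra_simps flip: left_diff_distrib)
    also have "1 / \<alpha> * \<tau> l * N (- 1 - m) l = 1 / \<alpha> * t l * (1 - X (l - m - 1))"
      unfolding N_step(3) t_def by simp
    also have "\<tau> (l - 1) * N (- 1 - m) l = (1 - X (l - 1)) * t (l - 1)"
      unfolding N_step(4) t_def by simp
    finally show ?thesis .
  qed
  \<comment> \<open>The defect of e(z) from the inner formula with \<open>N (1 - m)\<close> divided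
    out. Both \<open>t l\<close> and \<open>t (l + 1)\<close> contain that factor, so
    \<open>U\<close> is again a polynomial in \<open>X\<close>.\<close>
  define U where "U l = R l - (\<alpha> * \<tau> l * (1 - X (l - m)) - \<tau> (l + 1) * (1 - X l))" for l
  have U: "U l * N (1 - m) l = R l * N (1 - m) l - (\<alpha> * t l - t (l + 1))" for l
  proof -
    have "\<alpha> * t l = \<alpha> * \<tau> l * (1 - X (l - m)) * N (1 - m) l"
      by (simp add: t_def N_step(1)[of l])
    moreover have "t (l + 1) = \<tau> (l + 1) * (1 - X l) * N (1 - m) l"
      by (simp add: t_def N_step(2)[of "l + 1"])
    ultimately show ?thesis by (simp add: U_def left_diff_distrib)
  qed
  have "qpoly U" unfolding U_def by (intro qpoly_intros \<tau>(1) R(1) qpoly_shift[OF \<tau>(1)])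
  moreover have "1 / \<alpha> * U l = q\<^sup>2 * U (l + - 1)" if "l < 0" for l
  proof -
    have "z \<otimes>\<^bsub>P\<^esub> e w \<oplus>\<^bsub>P\<^esub> e z \<otimes>\<^bsub>P\<^esub> k w = q\<^sup>2 \<odot>\<^bsub>P\<^esub> (w \<otimes>\<^bsub>P\<^esub> e z \<oplus>\<^bsub>P\<^esub> e w \<otimes>\<^bsub>P\<^esub> k z)"
      using arg_cong[OF disc_relation, of e] by (simp add: e_mult add smult e_one P.smult_zero)
    then have "\<rho> (z \<otimes>\<^bsub>P\<^esub> e w \<oplus>\<^bsub>P\<^esub> e z \<otimes>\<^bsub>P\<^esub> k w) (\<lambda>_. 1) l = \<rho> (q\<^sup>2 \<odot>\<^bsub>P\<^esub> (w \<otimes>\<^bsub>P\<^esub> e z \<oplus>\<^bsub>P\<^esub> e w \<otimes>\<^bsub>P\<^esub> k z)) (\<lambda>_. 1) l"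
      by simp
    then have "Q (l + 1) * N (- 1 - m) (l + 1) + R l * N (1 - m) l * (1 / \<alpha> * (1 - X (l - m)))
      = q\<^sup>2 * ((1 - X (l - 1)) * (R (l - 1) * N (1 - m) (l - 1)) + Q l * N (- 1 - m) l * \<alpha>)"
      using Q(2) R(2) by (simp add: \<rho>_add \<rho>_mult \<rho>_smult k_z k_w \<rho>_z \<rho>_w homog_def add_ac diff_add_eq)
    moreover have "X l = q\<^sup>2 * X (l - 1)" "X (l - m) = q\<^sup>2 * X (l - m - 1)"
      by (rule X_Suc)+
    moreover have "Q (l + 1) * N (- 1 - m) (l + 1) = 1 / \<alpha> * t (l + 1) * (1 - X (l - m)) - (1 - X l) * t l"
      using ew[of "l + 1"] by (simp add: algebra_simps)
    moreover have "R (l - 1) * N (1 - m) (l - 1) = U (l - 1) * N (1 - m) (l - 1) + (\<alpha> * t (l - 1) - t l)"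
      using U[of "l - 1"] by simp
    moreover have "R l * N (1 - m) l = U l * N (1 - m) l + (\<alpha> * t l - t (l + 1))"
      using U[of l] by simp
    moreover have "\<alpha> * (1 / \<alpha>) = 1" by simp
    moreover note ew[of l]
    ultimately have "1 / \<alpha> * (U l * N (1 - m) l * (1 - X (l - m)))
      = q\<^sup>2 * ((1 - X (l - 1)) * (U (l - 1) * N (1 - m) (l - 1)))"
      by (rule e_relation_cancel)
    then have "1 / \<alpha> * U l * N (- m) l = q\<^sup>2 * U (l - 1) * N (- m) l"
      using N_step(1)[of l] N_step(2)[of l] by (simp add: mult_ac)
    moreover have "N (- m) l \<noteq> 0" using that by (intro N_nz) simp
    ultimately show ?thesis by (metis mult_right_cancel uminus_add_conv_diff add.commute)
  qed
  \<comment> \<open>The case i = 0 is \<alpha> \<noteq> q^(-2); otherwise a nonzero constant defect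
    would satisfy the recursion.\<close>
  moreover have "1 / \<alpha> \<noteq> q\<^sup>2 * X (- 1 * int i)" for i
    using \<alpha>_neq_X[of "int i - 1"] X_Suc[of "int i"] q by (auto simp: X_minus field_simps)
  ultimately have U0: "U l = 0" for l by (rule qpoly_zero)
  have ez: "R l * N (1 - m) l = \<alpha> * t l - t (l + 1)" for l
    using U[of l] U0[of l] by simp
  have "\<rho> (e (gen (disc_rels q) g)) \<phi>
      = (\<lambda>l. T (\<rho> (k (gen (disc_rels q) g)) \<phi>) l - \<rho> (gen (disc_rels q) g) (T \<phi>) l)" for g \<phi>
  proof (cases g)
    case Z
    show ?thesis
      using R(2) by (auto simp: Z homog_def ez T_def k_z \<rho>_smult \<rho>_z fun_eq_iff algebra_simps)
  next
    case Zstar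
    show ?thesis
      using Q(2) by (auto simp: Zstar homog_def ew T_def k_w \<rho>_smult \<rho>_w fun_eq_iff algebra_simps)
  qed
  from e_inner[OF T this] have
    "\<rho> (e a) \<phi> l = t l * \<rho> (k a) \<phi> (l - m) - \<rho> a (\<lambda>i. t i * \<phi> (i - m)) l" if "a \<in> carrier P" for a \<phi> l
    using that by (simp add: T_def[abs_def])
  with tq t1 show ?thesis by (rule that)
qed

text \<open>The roles of the generators are exchanged: \<open>s\<close> is fitted to f(z), and the
  disc relation forces f(w). The degrees m + 1 and m - 1 are nonnegative, so no factor
  \<open>N\<close> occurs and the recursions hold for all l.\<close>

lemma f_weight_exists:
  obtains s where "qpoly s"
    "\<And>a \<phi> l. a \<in> carrier P \<Longrightarrow> \<rho> (f a) \<phi> l = s l * \<rho> a \<phi> (l + m) - \<rho> (ki a) (\<lambda>i. s i * \<phi> (i + m)) l"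
proof -
  obtain R where R: "qpoly R" "homog (1 + m) R (f z)"
    using grade_homog[OF f_grade[OF gen_grade[of Z]]] m by (auto simp: gen_degree_def)
  obtain V where V: "qpoly V" "homog (- 1 + m) V (f w)"
    using grade_homog[OF f_grade[OF gen_grade[of Zstar]]] m by (auto simp: gen_degree_def)
  have "1 \<noteq> 1 / \<alpha> * X (1 * int i)" for i
    using \<alpha>_neq_X[of "int i"] by (auto simp: field_simps)
  from qpoly_solve[OF R(1) this] obtain s where
    s: "qpoly s" "\<And>l. 1 * s l - 1 / \<alpha> * s (l + 1) = R l" by blast
  define T where "T \<phi> l = s l * \<phi> (l + m)" for \<phi> :: "int \<Rightarrow> complex" and l
  have T: "linear_op T" by (simp add: linear_op_def T_def fun_eq_iff algebra_simps)
  have fz: "R l = s l - 1 / \<alpha> * s (l + 1)" for l using s(2)[of l] by simp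
  define U where "U l = V l - (s l * (1 - X (l + m - 1)) - \<alpha> * (1 - X (l - 1)) * s (l - 1))" for l
  have "qpoly (\<lambda>l. s l * (1 - X (l + (m - 1))))" "qpoly (\<lambda>l. \<alpha> * (1 - X (l - 1)) * s (l - 1))"
    by (intro qpoly_intros s(1) qpoly_shift_minus[OF s(1)])+
  then have "qpoly U" unfolding U_def using V(1) by (intro qpoly_diff) (simp_all add: algebra_simps)
  moreover have "q\<^sup>2 * U l = 1 / \<alpha> * U (l + 1)" for l
  proof -
    have "f z \<otimes>\<^bsub>P\<^esub> w \<oplus>\<^bsub>P\<^esub> ki z \<otimes>\<^bsub>P\<^esub> f w = q\<^sup>2 \<odot>\<^bsub>P\<^esub> (f w \<otimes>\<^bsub>P\<^esub> z \<oplus>\<^bsub>P\<^esub> ki w \<otimes>\<^bsub>P\<^esub> f z)"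
      using arg_cong[OF disc_relation, of f] by (simp add: f_mult add smult f_one P.smult_zero)
    then have "\<rho> (f z \<otimes>\<^bsub>P\<^esub> w \<oplus>\<^bsub>P\<^esub> ki z \<otimes>\<^bsub>P\<^esub> f w) (\<lambda>_. 1) l = \<rho> (q\<^sup>2 \<odot>\<^bsub>P\<^esub> (f w \<otimes>\<^bsub>P\<^esub> z \<oplus>\<^bsub>P\<^esub> ki w \<otimes>\<^bsub>P\<^esub> f z)) (\<lambda>_. 1) l"
      by simp
    then have "R l * (1 - X (l + m)) + 1 / \<alpha> * V (l + 1)
      = q\<^sup>2 * (V l + \<alpha> * ((1 - X (l - 1)) * R (l - 1)))"
      using V(2) R(2) by (simp add: \<rho>_add \<rho>_mult \<rho>_smult ki_z ki_w \<rho>_z \<rho>_w homog_def algebra_simps)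
    moreover have "X l = q\<^sup>2 * X (l - 1)" "X (l + m) = q\<^sup>2 * X (l + m - 1)"
      by (rule X_Suc)+
    moreover have "V l = U l + (s l * (1 - X (l + m - 1)) - \<alpha> * (1 - X (l - 1)) * s (l - 1))"
      by (simp add: U_def)
    moreover have "V (l + 1) = U (l + 1) + (s (l + 1) * (1 - X (l + m)) - \<alpha> * (1 - X l) * s l)"
      by (simp add: U_def)
    moreover have "R (l - 1) = s (l - 1) - 1 / \<alpha> * s l" using fz[of "l - 1"] by simp
    moreover have "\<alpha> * (1 / \<alpha>) = 1" by simp
    moreover note fz[of l]
    ultimately show ?thesis by (rule f_relation_cancel)
  qed
  \<comment> \<open>Resonance would mean \<alpha> = q^(2(i-1)), so once more the value q^(-2) has to
    be excluded.\<close>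
  moreover have "q\<^sup>2 \<noteq> 1 / \<alpha> * X (1 * int i)" for i
    using \<alpha>_neq_X[of "int i - 1"] X_Suc[of "int i"] q by (auto simp: field_simps)
  ultimately have U0: "U l = 0" for l by (rule qpoly_zero)
  have fw: "V l = s l * (1 - X (l + m - 1)) - \<alpha> * (1 - X (l - 1)) * s (l - 1)" for l
    using U0[of l] by (simp add: U_def)
  have "\<rho> (f (gen (disc_rels q) g)) \<phi>
      = (\<lambda>l. T (\<rho> (gen (disc_rels q) g) \<phi>) l - \<rho> (ki (gen (disc_rels q) g)) (T \<phi>) l)" for g \<phi>
  proof (cases g)
    case Z
    show ?thesis
      using R(2) by (auto simp: Z homog_def fz T_def ki_z \<rho>_smult \<rho>_z fun_eq_iff algebra_simps)
  next
    case Zstar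
    show ?thesis
      using V(2) by (auto simp: Zstar homog_def fw T_def ki_w \<rho>_smult \<rho>_w fun_eq_iff algebra_simps)
  qed
  from f_inner[OF T this] have
    "\<rho> (f a) \<phi> l = s l * \<rho> a \<phi> (l + m) - \<rho> (ki a) (\<lambda>i. s i * \<phi> (i + m)) l" if "a \<in> carrier P" for a \<phi> l
    using that by (simp add: T_def[abs_def])
  with s(1) show ?thesis by (rule that)
qed

lemma contradiction: False
proof -
  obtain t where t: "qpoly t" "t 1 = 0" and e: "\<And>a \<phi> l. a \<in> carrier P \<Longrightarrow>
    \<rho> (e a) \<phi> l = t l * \<rho> (k a) \<phi> (l - m) - \<rho> a (\<lambda>i. t i * \<phi> (i - m)) l"
    by (rule e_weight_exists, rule that)
  obtain s where s: "qpoly s" and f: "\<And>a \<phi> l. a \<in> carrier P \<Longrightarrow>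
    \<rho> (f a) \<phi> l = s l * \<rho> a \<phi> (l + m) - \<rho> (ki a) (\<lambda>i. s i * \<phi> (i + m)) l"
    by (rule f_weight_exists, rule that)
  define F where "F l = t l * s (l - m)" for l
  define c where "c l = X (- 1) * F l - F (l + m)" for l
  have F: "qpoly F" unfolding F_def by (intro qpoly_intros t(1) qpoly_shift_minus[OF s])
  then have cq: "qpoly c" unfolding c_def by (intro qpoly_intros F qpoly_shift[OF F])
  \<comment> \<open>f(z) has degree m + 1, so k scales it by \<alpha>^(m+1), which is q^(-2)
    \<alpha>. Likewise the inverse of k scales e(z), of degree 1 - m, by \<alpha>^(m-1).\<close>
  have k_fz: "k (f z) = (\<alpha> * X (- 1)) \<odot>\<^bsub>P\<^esub> f z"
    using k_grade[OF f_grade[OF gen_grade[of Z]]] by (simp add: gen_degree_def power_int_add \<alpha>_m)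
  have ki_ez: "ki (e z) = (X (- 1) / \<alpha>) \<odot>\<^bsub>P\<^esub> e z"
    using ki_grade[OF e_grade[OF gen_grade[of Z]]] by (simp add: gen_degree_def power_int_diff \<alpha>_m)
  have fz: "\<rho> (f z) \<phi> l = (s l - s (l + 1) / \<alpha>) * \<phi> (l + m + 1)" for \<phi> l
    by (simp add: f ki_z \<rho>_smult \<rho>_z algebra_simps)
  have ez: "\<rho> (e z) \<phi> l = (\<alpha> * t l - t (l + 1)) * \<phi> (l + 1 - m)" for \<phi> l
    by (simp add: e k_z \<rho>_smult \<rho>_z algebra_simps)
  have c: "\<alpha> * c l = 1 / \<alpha> * c (l + 1) + \<kappa> * (\<alpha> - 1 / \<alpha>)" for l
  proof -
    \<comment> \<open>Applied to the constant function 1, a weighted shift returns its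
      weight.\<close>
    have "\<rho> (e (f z)) (\<lambda>_. 1) l - \<rho> (f (e z)) (\<lambda>_. 1) l = \<kappa> * (\<alpha> - 1 / \<alpha>)"
      using arg_cong[OF e_f[of z], of "\<lambda>a. \<rho> a (\<lambda>_. 1) l"]
      by (simp add: \<rho>_minus \<rho>_smult k_z ki_z \<rho>_z right_diff_distrib)
    moreover have "\<rho> (e (f z)) (\<lambda>_. 1) l
      = \<alpha> * X (- 1) * t l * (s (l - m) - 1 / \<alpha> * s (l - m + 1)) - (s l - 1 / \<alpha> * s (l + 1)) * t (l + m + 1)"
      by (simp add: e k_fz \<rho>_smult fz)
    moreover have "\<rho> (f (e z)) (\<lambda>_. 1) l
      = s l * (\<alpha> * t (l + m) - t (l + m + 1)) - X (- 1) * (1 / \<alpha>) * (\<alpha> * t l - t (l + 1)) * s (l + 1 - m)"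
      by (simp add: f ki_ez \<rho>_smult ez)
    moreover have "s (l - m + 1) = s (l + 1 - m)" "t (l + m + 1) = t (l + 1 + m)"
      by (simp_all add: algebra_simps)
    moreover have "c l = X (- 1) * (t l * s (l - m)) - t (l + m) * s l"
      "c (l + 1) = X (- 1) * (t (l + 1) * s (l + 1 - m)) - t (l + 1 + m) * s (l + 1)"
      by (simp_all add: c_def F_def)
    ultimately show ?thesis by (rule commutator_weight)
  qed
  have c_const: "c l = c 0" for l
  proof (rule qpoly_constant[OF cq])
    show "\<alpha> * c l = 1 / \<alpha> * c (l + 1) + \<kappa> * (\<alpha> - 1 / \<alpha>)" if "l < 0" for l by (rule c)
    \<comment> \<open>Resonance at x^i would mean \<alpha>^2 = q^(2i) with i \<ge> 0.\<close>
    show "\<alpha> \<noteq> 1 / \<alpha> * X (1 * int i)" for i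
      using \<alpha>2_neq_X[of "int i"] by (auto simp: field_simps power2_eq_square)
  qed
  have "(\<alpha> - 1 / \<alpha>) * c 0 = (\<alpha> - 1 / \<alpha>) * \<kappa>"
    using c[of 0] c_const[of 1] by (simp add: algebra_simps)
  \<comment> \<open>The case i = 0 of the same exclusion: \<alpha>^2 \<noteq> 1.\<close>
  moreover have "\<alpha> - 1 / \<alpha> \<noteq> 0"
    using \<alpha>2_neq_X[of 0] by (auto simp: field_simps power2_eq_square)
  ultimately have "c 0 = \<kappa>" by (metis mult_left_cancel)
  then have c0: "c l = \<kappa>" for l using c_const by metis
  have F_const: "F l = F 1" for l
  proof (rule qpoly_constant[OF F])
    show "X (- 1) * F l = 1 * F (l + m) + \<kappa>" if "l < 0" for l
      using c0[of l] by (simp add: c_def algebra_simps)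
    \<comment> \<open>The exponents -1 and m i have opposite signs, so no positive power of x is
      resonant.\<close>
    show "X (- 1) \<noteq> 1 * X (m * int i)" if "i > 0" for i
    proof
      assume "X (- 1) = 1 * X (m * int i)"
      then have "- 1 = m * int i" using inj_X by (simp add: inj_eq)
      then show False using m by (smt (verit) mult_nonneg_nonneg of_nat_0_le_iff)
    qed
  qed
  have "F 1 = 0" by (simp add: F_def t)
  then have "c 0 = 0" using F_const by (simp add: c_def)
  then show False using c0[of 0] kappa_nz by simp
qed

end

theorem proposition5p1:
  fixes q :: complex
  assumes "q \<noteq> 0"
    and "\<forall>m::nat. m > 0 \<longrightarrow> q ^ m \<noteq> 1"
  shows "\<not> (\<exists>\<pi> n. symmetry (Uq q) (Pol_disc q) \<pi> \<and> grading_jump q \<pi> n \<and> n < - 1)"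
proof clarify
  fix \<pi> n
  assume sym: "symmetry (Uq q) (Pol_disc q) \<pi>" and jump: "grading_jump q \<pi> n" and n: "n < - 1"
  interpret D: disc q
    using assms by unfold_locales auto
  interpret S: uq_symmetry q "presented_alg (disc_rels q)" \<pi>
    using assms sym by unfold_locales (simp_all add: Pol_disc_def)
  let ?x = "gen (uq_rels q)"
  \<comment> \<open>If e and f both vanished, the jump would be 0 by convention, contrary to n <
    -1.\<close>
  have nontriv: "\<exists>a\<in>carrier (presented_alg (disc_rels q)).
      \<pi> (?x UE) a \<noteq> \<zero>\<^bsub>presented_alg (disc_rels q)\<^esub> \<or> \<pi> (?x UF) a \<noteq> \<zero>\<^bsub>presented_alg (disc_rels q)\<^esub>"
    using jump n unfolding grading_jump_def Let_def Pol_disc_def by (auto split: if_splits)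
  then have grade: "\<pi> (?x UE) ` disc_grade q j \<subseteq> disc_grade q (j + n)"
    "\<pi> (?x UF) ` disc_grade q j \<subseteq> disc_grade q (j - n)" for j
    using jump unfolding grading_jump_def Let_def Pol_disc_def by (auto split: if_splits)
  interpret disc_action q "\<pi> (?x UE)" "\<pi> (?x UF)" "\<pi> (?x UK)" "\<pi> (?x UKinv)" "- n"
  proof
    fix a j
    show "\<pi> (?x UE) a \<in> disc_grade q (j - - n)" if "a \<in> disc_grade q j"
      using grade(1)[of j] that by auto
    show "\<pi> (?x UF) a \<in> disc_grade q (j + - n)" if "a \<in> disc_grade q j"
      using grade(2)[of j] that by auto
  qed (use n nontriv S.pi_relations S.pi_K_mult S.pi_E_mult S.pi_F_mult S.pi_add S.pi_smult in simp_all)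
  show False by (rule contradiction)
qed

end
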